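(* Let $p,q>0$ satisfy $\frac1p+\frac1q<\frac12$ and put $\alpha=1-2\big(\frac1p+\frac1q\big)$. Let $\psi(k;x)\in L_x^\infty(\mathbb{R},\mathbf{C}_k^{\alpha}(\mathbb{C}))$ and $r_\pm\in L^{q,2}(\mathbb{C})$. Then $\psi RT_{\mathbb{C}}(k;x)\in\mathbf{C}_k^\alpha(\mathbb{C})$, and the operator $RT_{\mathbb{C}}(k;x)$ on $\mathbf{C}_k^\alpha(\mathbb{C})$ satisfies $$\|RT_{\mathbb{C}}(k;x)\|_{\mathbf{C}_k^{\alpha}(\mathbb{C})\to\mathbf{C}_k^\alpha(\mathbb{C})}\le M^{p,q,\alpha}\big(\|r_+\|_{L^{q,2}(\mathbb{C})}+\|r_-\|_{L^{q,2}(\mathbb{C})}\big)$$ for $x\in\mathbb{R}$, where $M^{p,q,\alpha}$ is a positive constant depending on $p,q,\alpha$ (and not on $x$ or $r_\pm$).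
   Context: Throughout $k=k_R+ik_I\in\mathbb{C}$ is a spectral parameter, $x\in\mathbb{R}$, and functions of $k$ need not be analytic. $\mathbb{C}^\pm=\{k:\mathrm{Im}\,k\gtrless0\}$ and $E_1=\{k:|k|\le1\}$. Spaces. For real $\nu$ put $f_{(\nu)}(k)=|k|^{-\nu}f(k^{-1})$. $L^{p,\nu}(\mathbb{C})$ is the set of $f$ on $\mathbb{C}$ with $f,f_{(\nu)}\in L^p(E_1)$, with norm $\|f\|_{L^{p,\nu}(\mathbb{C})}=\|f\|_{L^p(E_1)}+\|f_{(\nu)}\|_{L^p(E_1)}$. For $0<\alpha\le1$, $C^\alpha(E_1)$ is the Banach space of functions with finite norm $\|f\|_{C^\alpha(E_1)}=\sup_{E_1}|f|+\sup_{k_1\ne k_2\in E_1}\frac{|f(k_1)-f(k_2)|}{|k_1-k_2|^\alpha}$. $C^\alpha(\mathbb{C})=\{f: f(k)\in C^\alpha(E_1),\ f(k^{-1})\in C^\alpha(E_1)\}$, with norm $\|f(k)\|_{C^\alpha(E_1)}+\|f(k^{-1})\|_{C^\alpha(E_1)}$. Bold letters ($\mathbf{C}^\alpha$) denote the corresponding spaces of $2\times2$ matrix functions, with absolute value replaced by a fixed matrix norm $\|\cdot\|$. $L_x^\infty(\mathbb{R},Y_k)$ is the set of $\psi(k;x)$ with $\sup_{x\in\mathbb{R}}\|\psi(\cdot;x)\|_{Y}<\infty$. Operator. Given scalar functions $r_\pm(k)$, let $$w_-(k;x)=\begin{pmatrix}0&0\\ r_-(k)e^{2ikx}&0\end{pmatrix},\qquad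 w_+(k;x)=\begin{pmatrix}0&r_+(k)e^{-2ikx}\\0&0\end{pmatrix},\qquad R=w_-+w_+ .$$ For $G=\mathbb{C}^+$ or $\mathbb{C}^-$ and $w=w_+$ or $w_-$ put $\psi wT_{G}(k;x)=\frac1{2\pi i}\iint_{G}\frac{\psi(z;x)w(z;x)}{z-k}\,dz\wedge d\bar z$. The operator $RT_{\mathbb{C}}$, acting to the left on $2\times2$ matrix functions $\psi$, is defined by $$\psi RT_{\mathbb{C}}(k;x)=[\psi w_-T_{\mathbb{C}^+}(k;x)+\psi w_+T_{\mathbb{C}^-}(k;x)]\chi_{\{x>0\}}+[\psi w_-T_{\mathbb{C}^-}(k;x)+\psi w_+T_{\mathbb{C}^+}(k;x)]\chi_{\{x<0\}},$$ with $\chi$ the indicator function. *)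

theory Defs
  imports "HOL-Analysis.Analysis"
begin

definition E1 :: "complex set" where
  "E1 = cball 0 1"

definition upper_half_plane :: "complex set" where
  "upper_half_plane = {k. Im k > 0}"

definition lower_half_plane :: "complex set" where
  "lower_half_plane = {k. Im k < 0}"


definition Lp_on :: "real \<Rightarrow> complex set \<Rightarrow> (complex \<Rightarrow> complex) set" where
  "Lp_on p S = {f. f \<in> borel_measurable (lebesgue_on S) \<and>
                   integrable (lebesgue_on S) (\<lambda>k. norm (f k) powr p)}"

definition Lp_norm_on :: "real \<Rightarrow> complex set \<Rightarrow> (complex \<Rightarrow> complex) \<Rightarrow> real" where
  "Lp_norm_on p S f = (\<integral>k. norm (f k) powr p \<partial>lebesgue_on S) powr (1 / p)"

(* The value at k = 0 is irrelevant: it is only used up to null sets. *)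
definition weighted_inversion :: "real \<Rightarrow> (complex \<Rightarrow> complex) \<Rightarrow> complex \<Rightarrow> complex" where
  "weighted_inversion \<nu> f k = of_real (norm k powr (- \<nu>)) * f (inverse k)"

definition Lpnu :: "real \<Rightarrow> real \<Rightarrow> (complex \<Rightarrow> complex) set" where
  "Lpnu p \<nu> = {f. f \<in> Lp_on p E1 \<and> weighted_inversion \<nu> f \<in> Lp_on p E1}"

definition Lpnu_norm :: "real \<Rightarrow> real \<Rightarrow> (complex \<Rightarrow> complex) \<Rightarrow> real" where
  "Lpnu_norm p \<nu> f = Lp_norm_on p E1 f + Lp_norm_on p E1 (weighted_inversion \<nu> f)"


definition cscale :: "complex \<Rightarrow> complex^2^2 \<Rightarrow> complex^2^2" where
  "cscale c A = (\<chi> i j. c * A $ i $ j)"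

(* Any norm on the complex vector space of 2 x 2 matrices; submultiplicativity is not required. *)
definition is_matrix_norm :: "(complex^2^2 \<Rightarrow> real) \<Rightarrow> bool" where
  "is_matrix_norm N \<longleftrightarrow>
     (\<forall>A. N A \<ge> 0) \<and>
     (\<forall>A. N A = 0 \<longleftrightarrow> A = 0) \<and>
     (\<forall>c A. N (cscale c A) = norm c * N A) \<and>
     (\<forall>A B. N (A + B) \<le> N A + N B)"


(* Norms of function spaces take values in [0, infinity], so that a function
   belongs to the space exactly if its norm is finite. *)
definition hoelder_norm_on ::
  "(complex^2^2 \<Rightarrow> real) \<Rightarrow> real \<Rightarrow> complex set \<Rightarrow> (complex \<Rightarrow> complex^2^2) \<Rightarrow> ennreal" where
  "hoelder_norm_on N \<alpha> S f =
     (SUP k\<in>S. ennreal (N (f k))) +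
     (SUP (k1, k2)\<in>{(k1, k2). k1 \<in> S \<and> k2 \<in> S \<and> k1 \<noteq> k2}.
        ennreal (N (f k1 - f k2) / norm (k1 - k2) powr \<alpha>))"

(* f (1/k) is only defined for k \<noteq> 0 (whereas inverse 0 = 0 here). A Hoelder function on the
   punctured disc extends uniquely to the disc, with the same norm, so the origin is removed. *)
definition Calpha_norm ::
  "(complex^2^2 \<Rightarrow> real) \<Rightarrow> real \<Rightarrow> (complex \<Rightarrow> complex^2^2) \<Rightarrow> ennreal" where
  "Calpha_norm N \<alpha> f =
     hoelder_norm_on N \<alpha> E1 f + hoelder_norm_on N \<alpha> (E1 - {0}) (\<lambda>k. f (inverse k))"

definition Calpha ::
  "(complex^2^2 \<Rightarrow> real) \<Rightarrow> real \<Rightarrow> (complex \<Rightarrow> complex^2^2) set" where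
  "Calpha N \<alpha> = {f. Calpha_norm N \<alpha> f < \<infinity>}"

definition Linf_Calpha ::
  "(complex^2^2 \<Rightarrow> real) \<Rightarrow> real \<Rightarrow> (complex \<Rightarrow> real \<Rightarrow> complex^2^2) set" where
  "Linf_Calpha N \<alpha> = {\<psi>. (SUP x. Calpha_norm N \<alpha> (\<lambda>k. \<psi> k x)) < \<infinity>}"

definition Calpha_opnorm ::
  "(complex^2^2 \<Rightarrow> real) \<Rightarrow> real \<Rightarrow>
   ((complex \<Rightarrow> complex^2^2) \<Rightarrow> (complex \<Rightarrow> complex^2^2)) \<Rightarrow> ennreal" where
  "Calpha_opnorm N \<alpha> T = (SUP \<psi>\<in>{\<psi>\<in>Calpha N \<alpha>. Calpha_norm N \<alpha> \<psi> \<le> 1}. Calpha_norm N \<alpha> (T \<psi>))"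


definition w_minus :: "(complex \<Rightarrow> complex) \<Rightarrow> complex \<Rightarrow> real \<Rightarrow> complex^2^2" where
  "w_minus r k x = vector [vector [0, 0],
                           vector [r k * exp (2 * \<i> * k * of_real x), 0]]"

definition w_plus :: "(complex \<Rightarrow> complex) \<Rightarrow> complex \<Rightarrow> real \<Rightarrow> complex^2^2" where
  "w_plus r k x = vector [vector [0, r k * exp (- 2 * \<i> * k * of_real x)],
                          vector [0, 0]]"

(* The factor -2i comes from dz \<and> d(cnj z) = -2i d(Re z) d(Im z). *)
definition cauchy_T :: "complex set \<Rightarrow> (complex \<Rightarrow> complex^2^2) \<Rightarrow> complex \<Rightarrow> complex^2^2" where
  "cauchy_T G F k =
     cscale (1 / (2 * of_real pi * \<i>))
       (LINT z:G|lebesgue. cscale (- 2 * \<i>) (cscale (1 / (z - k)) (F z)))"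

(* Operator at a fixed x; for \<psi> depending on x, the value \<psi> RT (k; x) is
   RT rp rm x (\<lambda>z. \<psi> z x) k. *)
definition RT ::
  "(complex \<Rightarrow> complex) \<Rightarrow> (complex \<Rightarrow> complex) \<Rightarrow> real \<Rightarrow>
   (complex \<Rightarrow> complex^2^2) \<Rightarrow> complex \<Rightarrow> complex^2^2" where
  "RT rp rm x \<psi> k =
     indicator {0<..} x *\<^sub>R
       (cauchy_T upper_half_plane (\<lambda>z. \<psi> z ** w_minus rm z x) k +
        cauchy_T lower_half_plane (\<lambda>z. \<psi> z ** w_plus rp z x) k) +
     indicator {..<0} x *\<^sub>R
       (cauchy_T lower_half_plane (\<lambda>z. \<psi> z ** w_minus rm z x) k +
        cauchy_T upper_half_plane (\<lambda>z. \<psi> z ** w_plus rp z x) k)"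

end

theory Submission
  imports Defs
begin

text \<open>
  At a fixed \<open>x\<close> the operator multiplies \<open>\<psi>\<close> by a matrix whose one nonzero entry is
  \<open>r\<^sub>\<plusminus>\<close> times an exponential, and then integrates against the Cauchy kernel over a half plane. The
  half planes are paired with the sign of \<open>x\<close> in such a way that the exponential has modulus at most
  1 where it is integrated. So the integrand is dominated by a constant times \<open>|r\<^sub>\<plusminus>(z)| / |z - k|\<close>,
  uniformly in \<open>x\<close>, and the theorem is the classical fact that the Cauchy transform maps
  \<open>L\<^sup>q\<close>, \<open>q > 2\<close>, into Hoelder functions, in a form that is uniform on the Riemann sphere.
  
  Three ideas carry the proof. First, with \<open>d = |k\<^sub>1 - k\<^sub>2|\<close>, the triangle inequality gives
  \<open>|1/(z - k\<^sub>1) - 1/(z - k\<^sub>2)| \<le> 2 d\<^sup>\<alpha> (|z - k\<^sub>1| powr -(1+\<alpha>) + |z - k\<^sub>2| powr -(1+\<alpha>))\<close>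
  (\<open>difference_kernel\<close>). So both the supremum bound and the Hoelder bound follow from bounds on the
  potentials \<open>\<integral> |r(z)| |z - k| powr -s\<close> with \<open>s = 1\<close> and \<open>s = 1 + \<alpha>\<close>.
  
  Second, those potentials are bounded by the norm of \<open>r\<close> as soon as \<open>1 \<le> s < 2 - 2/q\<close>
  (\<open>Lpnu_potential_bounded\<close>). The \<open>L\<^sup>q\<^sup>,\<^sup>2\<close> norm amounts to a weighted \<open>L\<^sup>q\<close> norm over the plane with
  weight \<open>max 1 |z| powr (2q - 4)\<close>; by Young's inequality it remains to integrate the dual power of
  the kernel, which is integrable near \<open>k\<close> because \<open>s q' < 2\<close> and at infinity because of the weight.
  For \<open>s = 1 + \<alpha>\<close> the condition reads \<open>\<alpha> < 1 - 2/q\<close>, and that holds because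
  \<open>\<alpha> = 1 - 2/p - 2/q\<close> with \<open>p > 0\<close>.
  
  Third, the behaviour near infinity is reduced to the unit disc by the substitution \<open>z = 1/w\<close>, with
  Jacobian \<open>|w| powr -4\<close> (\<open>nn_integral_inverse\<close>). Differences of Cauchy kernels are invariant under
  inversion up to the factor \<open>- w\<^sup>2\<close>, so that \<open>|w| powr -4\<close> splits into a factor
  \<open>|w| powr -2\<close> that restores the kernel and another that turns \<open>r(1/w)\<close> into the weighted inversion
  of \<open>r\<close>. The weighted inversion preserves the norm of \<open>L\<^sup>q\<^sup>,\<^sup>2\<close> (\<open>weighted_inversion_Lpnu\<close>).
\<close>

section \<open>Inversion of the complex plane as a change of variables\<close>

text \<open>
  The change of variables theorem speaks about Cartesian powers of the reals, so the complex plane is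
  identified with \<open>real^2\<close> until the Jacobian of the inversion has been computed.
\<close>

definition cx_of_vec :: "real^2 \<Rightarrow> complex" where
  "cx_of_vec x = Complex (x$1) (x$2)"

lemma cx_of_vec_linear: "bounded_linear cx_of_vec"
proof (rule linear_conv_bounded_linear[THEN iffD1], rule linearI)
qed (auto simp: cx_of_vec_def complex_eq_iff)

lemma cx_of_vec_measurable [measurable]: "cx_of_vec \<in> borel_measurable borel"
  using cx_of_vec_linear by (simp add: borel_measurable_continuous_onI linear_continuous_on)

lemma lborel_complex_eq_distr: "(lborel :: complex measure) = distr lborel borel cx_of_vec"
proof (rule lborel_eqI)
  fix l u :: complex
  assume le: "\<And>b. b \<in> Basis \<Longrightarrow> l \<bullet> b \<le> u \<bullet> b"
  have le': "Re l \<le> Re u" "Im l \<le> Im u"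
    using le[of 1] le[of \<i>] by (auto simp: Basis_complex_def)
  let ?L = "vector [Re l, Im l] :: real^2" and ?U = "vector [Re u, Im u] :: real^2"
  have "cx_of_vec -` box l u = box ?L ?U"
    by (auto simp: cx_of_vec_def mem_box Basis_complex_def Basis_vec_def inner_axis forall_2)
  moreover have "(\<Prod>b\<in>Basis. (?U - ?L) \<bullet> b) = (Re u - Re l) * (Im u - Im l)"
    by (simp add: Basis_vec_def UNION_singleton_eq_range prod.reindex inj_on_def axis_eq_axis
        inner_axis UNIV_2)
  ultimately have "emeasure lborel (cx_of_vec -` box l u) = ennreal ((Re u - Re l) * (Im u - Im l))"
    using le' by (simp add: emeasure_lborel_box_eq Basis_vec_def inner_axis forall_2)
  then show "emeasure (distr lborel borel cx_of_vec) (box l u) = ennreal (\<Prod>b\<in>Basis. (u - l) \<bullet> b)"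
    by (simp add: emeasure_distr Basis_complex_def)
qed simp

definition vec_of_cx :: "complex \<Rightarrow> real^2" where
  "vec_of_cx z = vector [Re z, Im z]"

lemma vec_of_cx_linear: "bounded_linear vec_of_cx"
proof (rule linear_conv_bounded_linear[THEN iffD1], rule linearI)
qed (auto simp: vec_of_cx_def vec_eq_iff forall_2)

lemma vec_of_cx_inverse [simp]: "cx_of_vec (vec_of_cx z) = z" "vec_of_cx (cx_of_vec x) = x"
  by (auto simp: cx_of_vec_def vec_of_cx_def vec_eq_iff forall_2)

definition plane_inversion :: "real^2 \<Rightarrow> real^2" where "plane_inversion x = vec_of_cx (inverse (cx_of_vec x))"

lemma cx_of_vec_eq_0 [simp]: "cx_of_vec x = 0 \<longleftrightarrow> x = 0"
  by (auto simp: cx_of_vec_def complex_eq_iff vec_eq_iff forall_2)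

lemma plane_inversion_has_derivative:
  assumes "x \<noteq> 0"
  shows "(plane_inversion has_derivative (\<lambda>h. vec_of_cx (- (inverse (cx_of_vec x) ^ 2) * cx_of_vec h))) (at x within S)"
proof -
  have "(inverse has_derivative (\<lambda>h. - (inverse (cx_of_vec x) * h * inverse (cx_of_vec x)))) (at (cx_of_vec x))"
    by (rule has_derivative_inverse') (use assms in auto)
  from has_derivative_compose[OF bounded_linear_imp_has_derivative[OF cx_of_vec_linear] this]
  have "((\<lambda>x. inverse (cx_of_vec x)) has_derivative (\<lambda>h. - (inverse (cx_of_vec x) * cx_of_vec h * inverse (cx_of_vec x)))) (at x within S)"
    by simp
  from has_derivative_compose[OF this bounded_linear_imp_has_derivative[OF vec_of_cx_linear]]
  show ?thesis unfolding plane_inversion_def by (simp add: power2_eq_square mult_ac)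
qed

lemma det_complex_mult:
  "det (matrix (\<lambda>h. vec_of_cx (c * cx_of_vec h))) = (norm c)^2"
  unfolding cmod_power2 by (simp add: det_2 matrix_def cx_of_vec_def vec_of_cx_def axis_def power2_eq_square)


text \<open>
  This is the change of variables theorem for the indicator of a box under the inversion of
  \<open>- {0}\<close>; the derivative of the inversion at \<open>z\<close> is multiplication by \<open>- z powi -2\<close>, whose
  determinant as a real map is \<open>|z| powr -4\<close>. Boxes are bounded, hence the indicator is absolutely
  integrable as that theorem demands, even when the preimage is unbounded.
\<close>

lemma nn_integral_inverse_box:
  fixes l u :: complex
  shows "(\<integral>\<^sup>+z. indicator (box l u) (inverse z) * ennreal (norm z powr - 4) \<partial>lborel) = emeasure lborel (box l u)"
proof -
  let ?A = "cx_of_vec -` box l u"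
  let ?f = "\<lambda>x. vec (indicator ?A x) :: real^1"
  let ?d = "\<lambda>x::real^2. norm (cx_of_vec x) powr - 4"
  have bA: "?A = box (vec_of_cx l) (vec_of_cx u)"
    by (auto simp: cx_of_vec_def vec_of_cx_def mem_box Basis_complex_def Basis_vec_def inner_axis forall_2)
  have invol: "plane_inversion (plane_inversion x) = x" for x by (simp add: plane_inversion_def)
  have vinv0: "plane_inversion x = 0 \<longleftrightarrow> x = 0" for x
    by (metis cx_of_vec_eq_0 inverse_nonzero_iff_nonzero vec_of_cx_inverse(1) plane_inversion_def)
  have img: "plane_inversion ` (- {0}) = - {0}"
  proof
    show "- {0} \<subseteq> plane_inversion ` (- {0})"
    proof
      fix x :: "real^2" assume "x \<in> - {0}"
      then have "plane_inversion x \<in> - {0}" by (simp add: vinv0)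
      then show "x \<in> plane_inversion ` (- {0})" using invol[of x] by (metis imageI)
    qed
  qed (auto simp: vinv0)
  have inj: "inj_on plane_inversion (-{0})"
    by (rule inj_on_inverseI[where g = plane_inversion]) (simp add: invol)
  have [measurable]: "?A \<in> sets borel" unfolding bA by simp
  define m where "m = measure lebesgue (?A - {0})"
  have "?A \<in> lmeasurable" unfolding bA by simp
  then have lm: "?A - {0} \<in> lmeasurable" by (intro fmeasurable_Diff) auto
  have "(indicator (?A - {0}) :: real^2 \<Rightarrow> real) absolutely_integrable_on UNIV"
    using lm by (simp add: lmeasurable_iff_integrable set_integrable_def)
  moreover have "(\<lambda>x. if x \<in> - {0} then indicator ?A x else 0 :: real) = indicator (?A - {0})"
    by (auto simp: fun_eq_iff indicator_def)
  ultimately have "(\<lambda>x. if x \<in> - {0} then indicator ?A x else 0 :: real) absolutely_integrable_on UNIV"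
    by simp
  then have ai: "(indicator ?A :: real^2 \<Rightarrow> real) absolutely_integrable_on - {0}"
    by (rule absolutely_integrable_restrict_UNIV[THEN iffD1])
  have "integral UNIV (indicator (?A-{0}) :: real^2 \<Rightarrow> real) = m"
    using lmeasure_integral_UNIV[OF lm] unfolding m_def by simp
  moreover have "integral (-{0}) (indicator ?A :: real^2 \<Rightarrow> real) = integral UNIV (indicator (?A-{0}) :: real^2 \<Rightarrow> real)"
    unfolding integral_restrict_UNIV[symmetric, of "-{0}"] by (rule integral_cong) (auto simp: indicator_def)
  ultimately have int: "integral (-{0}) (indicator ?A :: real^2 \<Rightarrow> real) = m" by simp
  let ?v' = "\<lambda>x h. vec_of_cx (- (inverse (cx_of_vec x) ^ 2) * cx_of_vec h)"
  have "(\<lambda>x. \<bar>det (matrix (?v' x))\<bar> *\<^sub>R ?f (plane_inversion x)) absolutely_integrable_on -{0} \<and>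
         integral (-{0}) (\<lambda>x. \<bar>det (matrix (?v' x))\<bar> *\<^sub>R ?f (plane_inversion x)) = vec m
       \<longleftrightarrow> ?f absolutely_integrable_on plane_inversion ` (-{0}) \<and> integral (plane_inversion ` (-{0})) ?f = vec m"
    by (rule has_absolute_integral_change_of_variables[OF _ _ inj]) (simp, rule plane_inversion_has_derivative, simp)
  moreover have "?f absolutely_integrable_on plane_inversion ` (-{0}) \<and> integral (plane_inversion ` (-{0})) ?f = vec m"
    using ai int by (simp add: img absolutely_integrable_on_1_iff integral_on_1_eq)
  ultimately have "(\<lambda>x. \<bar>det (matrix (?v' x))\<bar> *\<^sub>R ?f (plane_inversion x)) absolutely_integrable_on -{0} \<and>
         integral (-{0}) (\<lambda>x. \<bar>det (matrix (?v' x))\<bar> *\<^sub>R ?f (plane_inversion x)) = vec m"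
    by blast
  then have ai2: "(\<lambda>x. \<bar>det (matrix (?v' x))\<bar> * indicator ?A (plane_inversion x)) absolutely_integrable_on -{0}"
    and int2: "integral (-{0}) (\<lambda>x. \<bar>det (matrix (?v' x))\<bar> * indicator ?A (plane_inversion x)) = m"
    by (auto simp: absolutely_integrable_on_1_iff integral_on_1_eq vec_eq_iff)
  have hi: "((\<lambda>x. \<bar>det (matrix (?v' x))\<bar> * indicator ?A (plane_inversion x)) has_integral m) (-{0})"
    unfolding has_integral_integrable_integral
    using set_lebesgue_integral_eq_integral(1)[OF ai2] int2 by blast
  have d: "\<bar>det (matrix (?v' x))\<bar> = ?d x" if "x \<noteq> 0" for x
    unfolding det_complex_mult using that
    by (simp add: norm_power norm_inverse powr_minus power_inverse flip: power_mult)
  have "((\<lambda>x. ?d x * indicator ?A (plane_inversion x)) has_integral m) (-{0})"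
    by (rule has_integral_eq[OF _ hi]) (use d in auto)
  from nn_integral_has_integral_lebesgue[OF _ this]
  have *: "(\<integral>\<^sup>+x. indicator (-{0}) x * (?d x * indicator ?A (plane_inversion x)) \<partial>lborel) = m" by simp
  have "(\<integral>\<^sup>+z. indicator (box l u) (inverse z) * ennreal (norm z powr - 4) \<partial>lborel)
      = (\<integral>\<^sup>+x. indicator (box l u) (inverse (cx_of_vec x)) * ennreal (?d x) \<partial>lborel)"
    unfolding lborel_complex_eq_distr by (subst nn_integral_distr) auto
  also have "\<dots> = (\<integral>\<^sup>+x. indicator (-{0}) x * (?d x * indicator ?A (plane_inversion x)) \<partial>lborel)"
    by (rule nn_integral_cong) (auto simp: indicator_def plane_inversion_def)
  also have "\<dots> = emeasure lebesgue (?A - {0})"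
    unfolding * m_def using lm by (simp add: emeasure_eq_measure2)
  also have "\<dots> = emeasure lborel ?A"
    by (simp add: emeasure_Diff_null_set)
  also have "\<dots> = emeasure lborel (box l u)"
    unfolding lborel_complex_eq_distr by (simp add: emeasure_distr)
  finally show ?thesis .
qed

lemma inverse_borel [measurable]: "(inverse :: complex \<Rightarrow> complex) \<in> borel_measurable borel"
  by measurable

text \<open>
  Lebesgue measure is determined by its values on boxes, so the box case gives the change of
  variables for all Borel functions at once.
\<close>

lemma lborel_eq_distr_inverse:
  "(lborel :: complex measure) = distr (density lborel (\<lambda>z. ennreal (norm z powr - 4))) borel inverse"
proof (rule lborel_eqI)
  fix l u :: complex
  assume le: "\<And>b. b \<in> Basis \<Longrightarrow> l \<bullet> b \<le> u \<bullet> b"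
  have "emeasure (distr (density lborel (\<lambda>z. ennreal (norm z powr - 4))) borel inverse) (box l u)
     = (\<integral>\<^sup>+z. indicator (box l u) (inverse z) * ennreal (norm z powr - 4) \<partial>lborel)"
    by (simp add: emeasure_distr emeasure_density vimage_def indicator_def[abs_def] mult.commute
        del: indicator_simps)
  then show "emeasure (distr (density lborel (\<lambda>z. ennreal (norm z powr - 4))) borel inverse) (box l u) = (\<Prod>b\<in>Basis. (u - l) \<bullet> b)"
    using le by (simp add: nn_integral_inverse_box emeasure_lborel_box)
qed simp

lemma nn_integral_inverse_borel:
  assumes [measurable]: "f \<in> borel_measurable borel"
  shows "(\<integral>\<^sup>+z. f z \<partial>lborel) = (\<integral>\<^sup>+z. ennreal (norm z powr - 4) * f (inverse z) \<partial>(lborel :: complex measure))"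
  by (subst lborel_eq_distr_inverse) (simp add: nn_integral_distr nn_integral_density)


text \<open>
  Functions in the spaces below are only Lebesgue measurable; to invert their argument one needs that
  inversion pulls null sets back to null sets.
\<close>

lemma AE_inverse_notin_null_set:
  assumes Z: "Z \<in> null_sets lborel"
  shows "AE z in lborel. inverse (z :: complex) \<notin> Z"
proof -
  have [measurable]: "Z \<in> sets borel" using Z by auto
  have "(\<integral>\<^sup>+z. indicator Z z \<partial>lborel) = 0" using Z by (simp add: null_setsD1)
  then have "AE z in lborel. ennreal (norm z powr - 4) * indicator Z (inverse z) = 0"
    by (subst (asm) nn_integral_inverse_borel) (auto simp: nn_integral_0_iff_AE)
  with AE_lborel_singleton[of 0] show "AE z in lborel. inverse z \<notin> Z"
    by eventually_elim (auto simp: indicator_def split: if_splits)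
qed

lemma inverse_lebesgue [measurable]: "(inverse :: complex \<Rightarrow> complex) \<in> lebesgue \<rightarrow>\<^sub>M lebesgue"
proof (rule completion.measurable_completion2)
  show "(inverse :: complex \<Rightarrow> complex) \<in> lebesgue \<rightarrow>\<^sub>M lborel"
    by (rule measurable_completion) simp
  show "null_sets lborel \<subseteq> null_sets (distr lebesgue lborel (inverse :: complex \<Rightarrow> complex))"
  proof
    fix Z :: "complex set" assume Z: "Z \<in> null_sets lborel"
    then have [measurable]: "Z \<in> sets borel" by auto
    have "emeasure lborel {z \<in> space lborel. inverse z \<in> Z} = 0"
      using AE_inverse_notin_null_set[OF Z] by (subst AE_iff_measurable[symmetric]) auto
    then show "Z \<in> null_sets (distr lebesgue lborel inverse)"
      by (simp add: null_sets_def distr_completion emeasure_distr vimage_def)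
  qed
qed

lemma nn_integral_inverse:
  assumes "f \<in> borel_measurable lebesgue"
  shows "(\<integral>\<^sup>+z. f z \<partial>lebesgue) = (\<integral>\<^sup>+z. ennreal (norm z powr - 4) * f (inverse z) \<partial>(lebesgue :: complex measure))"
proof -
  obtain g where "g \<in> borel_measurable lborel" and fg: "AE z in lborel. f z = g z"
    using completion_ex_borel_measurable[OF assms] by auto
  then have [measurable]: "g \<in> borel_measurable borel" by simp
  from fg obtain Z where Z: "Z \<in> null_sets lborel" "{z. f z \<noteq> g z} \<subseteq> Z"
    by (auto simp: eventually_ae_filter)
  have "(\<integral>\<^sup>+z. f z \<partial>lborel) = (\<integral>\<^sup>+z. g z \<partial>lborel)"
    using fg by (rule nn_integral_cong_AE)
  also have "\<dots> = (\<integral>\<^sup>+z. ennreal (norm z powr - 4) * g (inverse z) \<partial>lborel)"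
    by (rule nn_integral_inverse_borel) simp
  also have "\<dots> = (\<integral>\<^sup>+z. ennreal (norm z powr - 4) * f (inverse z) \<partial>lborel)"
  proof (rule nn_integral_cong_AE)
    show "AE z in lborel. ennreal (norm z powr - 4) * g (inverse z) = ennreal (norm z powr - 4) * f (inverse z)"
      using AE_inverse_notin_null_set[OF Z(1)] by eventually_elim (use Z(2) in force)
  qed
  finally show ?thesis by (simp add: nn_integral_completion)
qed

section \<open>Integrals of the weighted kernels\<close>

lemma cball_borel_measurable [measurable]: "cball (c::complex) r \<in> sets borel"
  by simp

lemma norm_powr_lebesgue_measurable:
  "(\<lambda>z::complex. norm z powr c) \<in> borel_measurable lebesgue"
  by (rule measurable_completion) measurable

text \<open>
  With this form, products of powers of \<open>|z|\<close> and \<open>|1/z|\<close> are simplified by adding exponents. It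
  includes \<open>z = 0\<close>, where both sides vanish by convention.
\<close>

lemma norm_inverse_powr: "norm (inverse z) = norm (z::complex) powr - 1"
  by (cases "z = 0") (auto simp: norm_inverse powr_minus)

text \<open>
  On the annulus \<open>(1/2)^(n+1) < |w| \<le> (1/2)^n\<close> the power is at most \<open>(2 powr t)^(n+1)\<close>. Summing over
  dyadic discs replaces polar coordinates, and the discs have known area.
\<close>

lemma dyadic_powr_bound:
  fixes w :: complex
  assumes t: "0 \<le> t"
  shows "indicator (cball 0 1) w * ennreal (norm w powr - t)
    \<le> (\<Sum>n. ennreal ((2 powr t) ^ Suc n) * indicator (cball 0 ((1/2) ^ n)) w)"
proof (cases "w \<in> cball 0 1 \<and> w \<noteq> 0")
  case True
  then have "\<exists>n. (1/2) ^ n < norm w" by (intro real_arch_pow_inv) auto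
  then obtain n where n: "(1/2) ^ n < norm w" "\<And>m. m < n \<Longrightarrow> \<not> (1/2) ^ m < norm w"
    using exists_least_iff[of "\<lambda>n. (1/2) ^ n < norm w"] by blast
  then obtain m where m: "n = Suc m" using True by (cases n) auto
  have "norm w powr - t \<le> ((1/2) ^ Suc m) powr - t"
    using n(1) t m by (intro powr_mono2') auto
  also have "\<dots> = (2 powr t) ^ Suc m"
    by (simp add: powr_minus powr_powr powr_divide power_divide field_simps powr_mult flip: powr_realpow)
  finally have "indicator (cball 0 1) w * ennreal (norm w powr - t)
      \<le> ennreal ((2 powr t) ^ Suc m) * indicator (cball 0 ((1/2) ^ m)) w"
    using True n(2)[of m] m by (auto intro!: ennreal_leI)
  also have "\<dots> \<le> (\<Sum>n. ennreal ((2 powr t) ^ Suc n) * indicator (cball 0 ((1/2) ^ n)) w)"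
  proof -
    define f where "f n = ennreal ((2 powr t) ^ Suc n) * indicator (cball 0 ((1/2) ^ n)) w" for n
    have "sum f {m} \<le> suminf f" by (rule sum_le_suminf) auto
    then have "f m \<le> suminf f" by simp
    then show ?thesis unfolding f_def .
  qed
  finally show ?thesis .
qed auto

text \<open>
  The disc of radius \<open>(1/2)^n\<close> has area \<open>\<pi> / 4^n\<close>, so the dyadic bound is a geometric series with ratio
  \<open>2 powr t / 4 < 1\<close>.
\<close>

lemma nn_integral_disc_powr_finite:
  assumes t: "0 \<le> t" "t < 2"
  shows "(\<integral>\<^sup>+w. indicator (cball 0 1) w * ennreal (norm (w::complex) powr - t) \<partial>lborel) < \<infinity>"
proof -
  have lt: "2 powr t / 4 < (1::real)"
  proof -
    have "2 powr t < 2 powr (2::real)" using t by (intro powr_less_mono) auto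
    then show ?thesis by simp
  qed
  have "(\<integral>\<^sup>+w. indicator (cball 0 1) w * ennreal (norm (w::complex) powr - t) \<partial>lborel)
    \<le> (\<integral>\<^sup>+w. (\<Sum>n. ennreal ((2 powr t) ^ Suc n) * indicator (cball 0 ((1/2) ^ n)) (w::complex)) \<partial>lborel)"
    by (intro nn_integral_mono dyadic_powr_bound t)
  also have "\<dots> = (\<Sum>n. \<integral>\<^sup>+w. ennreal ((2 powr t) ^ Suc n) * indicator (cball 0 ((1/2) ^ n)) (w::complex) \<partial>lborel)"
    by (rule nn_integral_suminf) measurable
  also have "\<dots> = (\<Sum>n. ennreal (2 powr t * pi * (2 powr t / 4) ^ n))"
  proof (rule suminf_cong)
    fix n
    have "(\<integral>\<^sup>+w. ennreal ((2 powr t) ^ Suc n) * indicator (cball 0 ((1/2) ^ n)) (w::complex) \<partial>lborel)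
      = ennreal ((2 powr t) ^ Suc n) * ennreal (pi * ((1/2)^n)^2)"
      by (subst nn_integral_cmult_indicator) (auto simp: emeasure_cball unit_ball_vol_2)
    also have "\<dots> = ennreal (2 powr t * pi * (2 powr t / 4) ^ n)"
      by (subst ennreal_mult[symmetric]) (auto simp: power_divide power2_eq_square power_mult_distrib[symmetric])
    finally show "(\<integral>\<^sup>+w. ennreal ((2 powr t) ^ Suc n) * indicator (cball 0 ((1/2) ^ n)) (w::complex) \<partial>lborel)
       = ennreal (2 powr t * pi * (2 powr t / 4) ^ n)" .
  qed
  also have "\<dots> < \<infinity>"
  proof -
    have "summable (\<lambda>n. 2 powr t * pi * (2 powr t / 4) ^ n)"
      by (intro summable_mult summable_geometric) (use lt in auto)
    then show ?thesis by (subst suminf_ennreal2) auto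
  qed
  finally show ?thesis .
qed

text \<open>
  Inversion turns the integral of \<open>|w| powr -(t + b)\<close> outside the disc into that of
  \<open>|w| powr -(4 - (t + b))\<close> inside, so the singularity and the decay at infinity are both instances of
  the same integral over the disc.
\<close>

lemma nn_integral_weighted_powr_finite:
  assumes t: "0 \<le> t" "t < 2" and b: "2 < t + b" "t + b \<le> 4"
  shows "(\<integral>\<^sup>+w. ennreal (norm (w::complex) powr - t * max 1 (norm w) powr - b) \<partial>lborel) < \<infinity>"
proof -
  let ?D = "cball 0 1 :: complex set"
  have "(\<integral>\<^sup>+w. ennreal (norm (w::complex) powr - t * max 1 (norm w) powr - b) \<partial>lborel)
     = (\<integral>\<^sup>+w. indicator ?D w * ennreal (norm w powr - t) + indicator (- ?D) w * ennreal (norm w powr - (t + b)) \<partial>lborel)"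
    by (rule nn_integral_cong) (auto simp: indicator_def max_def powr_add[symmetric])
  also have "\<dots> = (\<integral>\<^sup>+w. indicator ?D w * ennreal (norm w powr - t) \<partial>lborel)
       + (\<integral>\<^sup>+w. indicator (- ?D) w * ennreal (norm w powr - (t + b)) \<partial>lborel)"
    by (rule nn_integral_add) auto
  finally have split: "(\<integral>\<^sup>+w. ennreal (norm (w::complex) powr - t * max 1 (norm w) powr - b) \<partial>lborel)
     = (\<integral>\<^sup>+w. indicator ?D w * ennreal (norm w powr - t) \<partial>lborel)
       + (\<integral>\<^sup>+w. indicator (- ?D) w * ennreal (norm w powr - (t + b)) \<partial>lborel)" .
  have "(\<integral>\<^sup>+w. indicator (- ?D) w * ennreal (norm w powr - (t + b)) \<partial>lborel)
     = (\<integral>\<^sup>+w. ennreal (norm w powr - 4) * (indicator (- ?D) (inverse w) * ennreal (norm (inverse w) powr - (t + b))) \<partial>lborel)"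
    by (rule nn_integral_inverse_borel) simp
  also have "\<dots> \<le> (\<integral>\<^sup>+w. indicator ?D w * ennreal (norm w powr - (4 - (t + b))) \<partial>lborel)"
  proof (rule nn_integral_mono)
    fix w :: complex
    have "norm w powr - 4 * norm (inverse w) powr - (t + b) = norm w powr - (4 - (t + b))"
      unfolding norm_inverse_powr powr_powr powr_add[symmetric] by (simp add: add.commute)
    moreover have "inverse w \<notin> ?D \<Longrightarrow> w \<in> ?D"
      by (cases "w = 0") (auto simp: norm_inverse norm_divide field_simps)
    ultimately show "ennreal (norm w powr - 4) * (indicator (- ?D) (inverse w) * ennreal (norm (inverse w) powr - (t + b)))
      \<le> indicator ?D w * ennreal (norm w powr - (4 - (t + b)))"
      by (auto simp: indicator_def ennreal_mult[symmetric])
  qed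
  also have "\<dots> < \<infinity>" using b by (intro nn_integral_disc_powr_finite) auto
  finally show ?thesis unfolding split using nn_integral_disc_powr_finite[OF t] by simp
qed

text \<open>
  For \<open>|k| \<le> 1\<close> the weights centred at \<open>0\<close> and at \<open>k\<close> differ by a factor of at most 2; after this
  exchange, translation invariance makes the integral independent of \<open>k\<close>.
\<close>

lemma nn_integral_shifted_kernel_bounded:
  assumes t: "0 \<le> t" "t < 2" and b: "0 \<le> b" "2 < t + b" "t + b \<le> 4"
  shows "\<exists>C\<ge>0. \<forall>k\<in>E1. (\<integral>\<^sup>+z. ennreal (norm (z - k) powr - t * max 1 (norm z) powr - b) \<partial>lebesgue) \<le> ennreal C"
proof -
  let ?f = "\<lambda>w::complex. norm w powr - t * max 1 (norm w) powr - b"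
  obtain C0 where C0: "C0 \<ge> 0" "(\<integral>\<^sup>+w. ennreal (?f w) \<partial>lborel) = ennreal C0"
    using nn_integral_weighted_powr_finite[OF t b(2,3)]
    by (cases "\<integral>\<^sup>+w. ennreal (?f w) \<partial>lborel") auto
  have "(\<integral>\<^sup>+z. ennreal (norm (z - k) powr - t * max 1 (norm z) powr - b) \<partial>lborel) \<le> ennreal (2 powr b * C0)"
    if k: "k \<in> E1" for k
  proof -
    have "(\<integral>\<^sup>+z. ennreal (norm (z - k) powr - t * max 1 (norm z) powr - b) \<partial>lborel)
      \<le> (\<integral>\<^sup>+z. ennreal (2 powr b) * ennreal (?f (-k + z)) \<partial>lborel)"
    proof (rule nn_integral_mono)
      fix z
      have "norm (z - k) \<le> norm z + 1"
        using norm_triangle_ineq4[of z k] k by (simp add: E1_def)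
      then have "max 1 (norm (z - k)) / 2 \<le> max 1 (norm z)" by (auto simp: max_def)
      then have "max 1 (norm z) powr - b \<le> (max 1 (norm (z - k)) / 2) powr - b"
        using b by (intro powr_mono2') auto
      also have "\<dots> = 2 powr b * max 1 (norm (z - k)) powr - b"
        by (simp add: powr_divide powr_minus field_simps)
      finally show "ennreal (norm (z - k) powr - t * max 1 (norm z) powr - b)
         \<le> ennreal (2 powr b) * ennreal (?f (-k + z))"
        by (auto simp: ennreal_mult[symmetric] mult.left_commute[of "2 powr b"] intro!: ennreal_leI mult_left_mono)
    qed
    also have "\<dots> = ennreal (2 powr b) * (\<integral>\<^sup>+z. ennreal (?f (-k + z)) \<partial>lborel)"
      by (rule nn_integral_cmult) simp
    finally have "(\<integral>\<^sup>+z. ennreal (norm (z - k) powr - t * max 1 (norm z) powr - b) \<partial>lborel)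
      \<le> ennreal (2 powr b) * (\<integral>\<^sup>+z. ennreal (?f (-k + z)) \<partial>lborel)" .
    moreover have "(\<integral>\<^sup>+z. ennreal (?f (-k + z)) \<partial>lborel) = (\<integral>\<^sup>+z. ennreal (?f z) \<partial>distr lborel borel ((+) (-k)))"
      by (rule nn_integral_distr[symmetric]) auto
    moreover have "\<dots> = ennreal C0" by (simp only: lborel_distr_plus C0)
    ultimately show ?thesis using C0 by (simp add: ennreal_mult)
  qed
  then show ?thesis using C0(1)
    by (intro exI[of _ "2 powr b * C0"]) (auto simp: nn_integral_completion)
qed

section \<open>The weighted spaces and their symmetry under inversion\<close>

lemma weighted_inversion_involution:
  "weighted_inversion \<nu> (weighted_inversion \<nu> r) = (\<lambda>z. indicator (- {0}) z *\<^sub>R r z)"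
proof
  fix z :: complex
  have 1: "norm z powr - \<nu> * norm (inverse z) powr - \<nu> = 1" if "z \<noteq> 0"
    unfolding norm_inverse_powr powr_powr powr_add[symmetric] using that by simp
  have "complex_of_real (norm z powr - \<nu>) * (complex_of_real (norm (inverse z) powr - \<nu>) * r z) = r z" if "z \<noteq> 0"
    by (simp only: mult.assoc[symmetric] of_real_mult[symmetric] 1[OF that] of_real_1 mult_1)
  then show "weighted_inversion \<nu> (weighted_inversion \<nu> r) z = indicator (- {0}) z *\<^sub>R r z"
    by (cases "z = 0") (auto simp: weighted_inversion_def)
qed

text \<open>
  Membership only asserts measurability of \<open>r\<close> and of its weighted inversion on the unit disc; outside
  the disc, \<open>r\<close> is recovered from its weighted inversion.
\<close>

lemma Lpnu_measurable:
  assumes "r \<in> Lpnu q \<nu>"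
  shows "r \<in> borel_measurable lebesgue"
proof -
  let ?g = "weighted_inversion \<nu> r"
  have E1: "E1 \<inter> space lebesgue \<in> sets lebesgue" by (simp add: E1_def)
  have [measurable]: "E1 \<in> sets lebesgue" using E1 by simp
  have r [measurable]: "(\<lambda>z. indicator E1 z *\<^sub>R r z) \<in> borel_measurable lebesgue"
    and g: "(\<lambda>z. indicator E1 z *\<^sub>R ?g z) \<in> borel_measurable lebesgue"
    using assms unfolding borel_measurable_restrict_space_iff[OF E1, symmetric]
    by (auto simp: Lpnu_def Lp_on_def)
  have g': "(\<lambda>z. indicator E1 (inverse z) *\<^sub>R ?g (inverse z)) \<in> borel_measurable lebesgue"
    using measurable_compose[OF inverse_lebesgue g] by simp
  \<comment> \<open>\<open>r'\<close> is assembled from the two functions whose measurability is given.\<close>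
  define r' where "r' = (\<lambda>z. indicator E1 z *\<^sub>R r z + indicator (-E1) z *\<^sub>R
       (complex_of_real (norm z powr - \<nu>) * (indicator E1 (inverse z) *\<^sub>R ?g (inverse z))))"
  have "r' \<in> borel_measurable lebesgue" unfolding r'_def
    by (rule borel_measurable_add[OF r borel_measurable_scaleR[OF _ borel_measurable_times[OF
        measurable_compose[OF norm_powr_lebesgue_measurable borel_measurable_of_real] g']]]) measurable
  moreover have "r = r'"
  proof
    fix z
    show "r z = r' z"
    proof (cases "z \<in> E1")
      case False
      then have "norm z > 1" by (simp add: E1_def)
      then have "inverse z \<in> E1" "z \<noteq> 0" by (auto simp: E1_def norm_inverse inverse_le_1_iff)
      have "r z = weighted_inversion \<nu> ?g z"
        using \<open>z \<noteq> 0\<close> by (simp add: weighted_inversion_involution)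
      also have "\<dots> = r' z"
        using \<open>inverse z \<in> E1\<close> False by (simp add: r'_def weighted_inversion_def[of _ ?g])
      finally show ?thesis .
    qed (simp add: r'_def)
  qed
  ultimately show ?thesis by simp
qed

text \<open>
  The bound is stated with a majorant \<open>l > 0\<close> of the norm, so that dividing by it stays meaningful
  for functions of norm zero.
\<close>

lemma Lp_norm_nn_integral:
  assumes f: "f \<in> Lp_on q S" and l: "Lp_norm_on q S f \<le> l" "0 < l" and q: "0 < q" and S: "S \<in> sets lebesgue"
  shows "(\<integral>\<^sup>+z. indicator S z * ennreal ((norm (f z) / l) powr q) \<partial>lebesgue) \<le> 1"
proof -
  let ?I = "\<integral>k. norm (f k) powr q \<partial>lebesgue_on S"
  have I0: "0 \<le> ?I" by (rule integral_nonneg_AE) auto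
  have "?I = (?I powr (1/q)) powr q" using q I0 by (simp add: powr_powr)
  also have "\<dots> \<le> l powr q" using l q by (intro powr_mono2) (auto simp: Lp_norm_on_def)
  finally have I: "?I \<le> l powr q" .
  have "(\<integral>\<^sup>+z. indicator S z * ennreal ((norm (f z) / l) powr q) \<partial>lebesgue)
     = (\<integral>\<^sup>+z. ennreal ((norm (f z) / l) powr q) \<partial>lebesgue_on S)"
    using S by (subst nn_integral_restrict_space) (auto simp: mult.commute)
  also have "\<dots> = (\<integral>\<^sup>+z. ennreal (norm (f z) powr q / l powr q) \<partial>lebesgue_on S)"
    using l by (simp add: powr_divide)
  also have "\<dots> = ennreal (\<integral>z. norm (f z) powr q / l powr q \<partial>lebesgue_on S)"
    by (rule nn_integral_eq_integral) (use f in \<open>auto simp: Lp_on_def\<close>)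
  also have "\<dots> = ennreal (?I / l powr q)" by simp
  also have "\<dots> \<le> 1" using I l by (simp add: divide_le_eq_1)
  finally show ?thesis .
qed

text \<open>
  The two halves of the norm become one integral over the plane. Outside the disc the substitution
  \<open>z = 1/w\<close> produces \<open>|w| powr -4\<close>, the weighted inversion absorbs \<open>|w| powr -2q\<close>, and the discrepancy
  is the weight \<open>max 1 |z| powr (2q - 4)\<close>.
\<close>

lemma Lpnu_norm_nn_integral:
  assumes r: "r \<in> Lpnu q 2" and l: "Lpnu_norm q 2 r \<le> l" "0 < l" and q: "0 < q"
  shows "(\<integral>\<^sup>+z. ennreal ((norm (r z) / l) powr q * max 1 (norm z) powr (2 * q - 4)) \<partial>lebesgue) \<le> 2"
proof -
  let ?g = "weighted_inversion 2 r"
  let ?h = "\<lambda>z. ennreal ((norm (r z) / l) powr q)"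
  have [measurable]: "r \<in> borel_measurable lebesgue" by (rule Lpnu_measurable[OF r])
  have [measurable]: "E1 \<in> sets lebesgue" by (simp add: E1_def)
  have [measurable]: "?h \<in> borel_measurable lebesgue"
    by (intro measurable_compose[OF _ measurable_ennreal] powr_real_measurable borel_measurable_divide
        borel_measurable_norm borel_measurable_const) measurable
  have hp: "(\<lambda>z. ?h z * ennreal (norm z powr (2 * q - 4))) \<in> borel_measurable lebesgue"
    by (intro borel_measurable_times_ennreal measurable_compose[OF norm_powr_lebesgue_measurable measurable_ennreal])
       measurable
  have hp': "(\<lambda>z. indicator (- E1) z * (?h z * ennreal (norm z powr (2 * q - 4)))) \<in> borel_measurable lebesgue"
    by (rule borel_measurable_times_ennreal[OF _ hp]) measurable
  have nn: "0 \<le> Lp_norm_on q E1 f" for f by (simp add: Lp_norm_on_def)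
  have lr: "Lp_norm_on q E1 r \<le> l" "Lp_norm_on q E1 ?g \<le> l"
    using l nn[of r] nn[of ?g] by (auto simp: Lpnu_norm_def)
  have "(\<integral>\<^sup>+z. ennreal ((norm (r z) / l) powr q * max 1 (norm z) powr (2 * q - 4)) \<partial>lebesgue)
     = (\<integral>\<^sup>+z. indicator E1 z * ?h z + indicator (- E1) z * (?h z * ennreal (norm z powr (2 * q - 4))) \<partial>lebesgue)"
    by (rule nn_integral_cong) (auto simp: indicator_def E1_def max_def ennreal_mult)
  also have "\<dots> = (\<integral>\<^sup>+z. indicator E1 z * ?h z \<partial>lebesgue)
      + (\<integral>\<^sup>+z. indicator (- E1) z * (?h z * ennreal (norm z powr (2 * q - 4))) \<partial>lebesgue)"
    by (rule nn_integral_add[OF _ hp']) measurable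
  finally have split: "(\<integral>\<^sup>+z. ennreal ((norm (r z) / l) powr q * max 1 (norm z) powr (2 * q - 4)) \<partial>lebesgue)
     = (\<integral>\<^sup>+z. indicator E1 z * ?h z \<partial>lebesgue)
      + (\<integral>\<^sup>+z. indicator (- E1) z * (?h z * ennreal (norm z powr (2 * q - 4))) \<partial>lebesgue)" .
  have "(\<integral>\<^sup>+z. indicator (- E1) z * (?h z * ennreal (norm z powr (2 * q - 4))) \<partial>lebesgue)
     = (\<integral>\<^sup>+z. ennreal (norm z powr - 4) * (indicator (- E1) (inverse z) *
          (?h (inverse z) * ennreal (norm (inverse z) powr (2 * q - 4)))) \<partial>lebesgue)"
    by (rule nn_integral_inverse[OF hp'])
  also have "\<dots> \<le> (\<integral>\<^sup>+z. indicator E1 z * ennreal ((norm (?g z) / l) powr q) \<partial>lebesgue)"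
  proof (rule nn_integral_mono)
    fix z
    show "ennreal (norm z powr - 4) * (indicator (- E1) (inverse z) *
          (?h (inverse z) * ennreal (norm (inverse z) powr (2 * q - 4))))
       \<le> indicator E1 z * ennreal ((norm (?g z) / l) powr q)"
    proof (cases "z = 0 \<or> inverse z \<in> E1")
      case False
      then have z: "z \<in> E1" "z \<noteq> 0" "norm z > 0" by (auto simp: E1_def norm_inverse norm_divide field_simps)
      have "norm z powr - 4 * norm (inverse z) powr (2 * q - 4) = (norm z powr - 2) powr q"
        unfolding norm_inverse_powr powr_powr powr_add[symmetric] by (simp add: algebra_simps)
      then have "norm z powr - 4 * ((norm (r (inverse z)) / l) powr q * norm (inverse z) powr (2 * q - 4))
         = (norm z powr - 2) powr q * (norm (r (inverse z)) / l) powr q"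
        by (simp add: mult.left_commute)
      also have "\<dots> = (norm (?g z) / l) powr q"
        using l by (simp add: weighted_inversion_def norm_mult powr_mult powr_divide)
      finally show ?thesis using z False
        by (simp add: ennreal_mult[symmetric])
    qed (auto simp: E1_def)
  qed
  also have "\<dots> \<le> 1"
    by (rule Lp_norm_nn_integral) (use r lr l q in \<open>auto simp: Lpnu_def\<close>)
  finally have outer: "(\<integral>\<^sup>+z. indicator (- E1) z * (?h z * ennreal (norm z powr (2 * q - 4))) \<partial>lebesgue) \<le> 1" .
  have "(\<integral>\<^sup>+z. indicator E1 z * ?h z \<partial>lebesgue) \<le> 1"
    by (rule Lp_norm_nn_integral) (use r lr l q in \<open>auto simp: Lpnu_def\<close>)
  from add_mono[OF this outer] show ?thesis unfolding split by simp
qed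


lemma AE_lebesgue_on_nonzero: "AE z in lebesgue_on E1. z \<noteq> (0::complex)"
proof -
  have "AE z in lebesgue. z \<noteq> (0::complex)" by (rule AE_completion[OF AE_lborel_singleton])
  then show ?thesis by (subst AE_restrict_space_iff) (auto simp: E1_def elim: eventually_mono)
qed

lemma weighted_inversion_Lpnu:
  assumes r: "r \<in> Lpnu q \<nu>"
  shows "weighted_inversion \<nu> r \<in> Lpnu q \<nu>"
    and "Lpnu_norm q \<nu> (weighted_inversion \<nu> r) = Lpnu_norm q \<nu> r"
proof -
  let ?r' = "\<lambda>z. indicator (- {0}) z *\<^sub>R r z"
  have rm [measurable]: "r \<in> borel_measurable (lebesgue_on E1)"
    and ri: "integrable (lebesgue_on E1) (\<lambda>k. norm (r k) powr q)"
    using r by (auto simp: Lpnu_def Lp_on_def)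
  have "- {0::complex} \<in> sets lebesgue" by simp
  then have im: "(indicator (- {0}) :: complex \<Rightarrow> real) \<in> borel_measurable (lebesgue_on E1)"
    by (intro measurable_restrict_space1 borel_measurable_indicator)
  have r'm: "?r' \<in> borel_measurable (lebesgue_on E1)" by (intro borel_measurable_scaleR rm im)
  have m: "(\<lambda>k. norm (f k) powr q) \<in> borel_measurable (lebesgue_on E1)"
    if "f \<in> borel_measurable (lebesgue_on E1)" for f :: "complex \<Rightarrow> complex"
    by (intro powr_real_measurable measurable_compose[OF that borel_measurable_norm] borel_measurable_const)
  have ae: "AE k in lebesgue_on E1. norm (?r' k) powr q = norm (r k) powr q"
    using AE_lebesgue_on_nonzero by eventually_elim simp
  have "integrable (lebesgue_on E1) (\<lambda>k. norm (?r' k) powr q)"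
    using ri integrable_cong_AE[OF m[OF r'm] m[OF rm] ae] by blast
  with r r'm show "weighted_inversion \<nu> r \<in> Lpnu q \<nu>"
    by (simp add: Lpnu_def Lp_on_def weighted_inversion_involution)
  have "Lp_norm_on q E1 ?r' = Lp_norm_on q E1 r"
    unfolding Lp_norm_on_def integral_cong_AE[OF m[OF r'm] m[OF rm] ae] ..
  then show "Lpnu_norm q \<nu> (weighted_inversion \<nu> r) = Lpnu_norm q \<nu> r"
    by (simp add: Lpnu_norm_def weighted_inversion_involution)
qed

lemma Lpnu_norm_nonneg: "0 \<le> Lpnu_norm q \<nu> r"
  by (simp add: Lpnu_norm_def Lp_norm_on_def)

section \<open>Potentials of functions in the weighted spaces\<close>

lemma product_le_powr_conjugates:
  fixes q a b :: real
  assumes "1 < q" "0 \<le> a" "0 \<le> b"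
  shows "a * b \<le> a powr q + b powr (q / (q - 1))"
proof -
  have "a * b \<le> a powr q / q + b powr (q / (q - 1)) / (q / (q - 1))"
    by (rule Youngs_inequality) (use assms in \<open>auto simp: field_simps\<close>)
  also have "\<dots> \<le> a powr q / 1 + b powr (q / (q - 1)) / 1"
    by (intro add_mono divide_left_mono) (use assms in \<open>auto simp: field_simps\<close>)
  finally show ?thesis by simp
qed

text \<open>
  For a majorant \<open>l > 0\<close> of the norm, Young's inequality with exponents \<open>q\<close> and \<open>q' = q/(q - 1)\<close> is
  applied to \<open>|r|/l\<close> times the \<open>q\<close>-th root of the weight, and to the kernel divided by that root. The
  first power integrates to at most 2, and the second has exponents \<open>t = s q' < 2\<close> and
  \<open>b = (2 - 4/q) q'\<close> with \<open>t + b > 2\<close>. Multiplying by \<open>l\<close> and letting \<open>l\<close> decrease to the norm gives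
  the estimate without a separate form of Hoelder's inequality.
\<close>

lemma Lpnu_potential_bounded:
  assumes q: "2 < q" and s: "1 \<le> s" "s < 2 - 2 / q"
  shows "\<exists>C>0. \<forall>r\<in>Lpnu q 2. \<forall>k\<in>E1.
    (\<integral>\<^sup>+z. ennreal (norm (r z) * norm (z - k) powr - s) \<partial>lebesgue) \<le> ennreal (C * Lpnu_norm q 2 r)"
proof -
  define q' where "q' = q / (q - 1)"
  define t where "t = s * q'"
  define b where "b = (2 - 4 / q) * q'"
  have q1: "q - 1 > 0" "q > 0" using q by auto
  have b: "b = (2 * q - 4) / (q - 1)" unfolding b_def q'_def using q1 by (simp add: field_simps)
  have q'0: "0 < q'" unfolding q'_def using q1 by simp
  have t0: "q' \<le> t" unfolding t_def using mult_right_mono[OF s(1), of q'] q'0 by simp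
  have "t < (2 - 2 / q) * q'" unfolding t_def using s q'0 by simp
  also have "\<dots> = 2" unfolding q'_def using q1 by (simp add: field_simps)
  finally have t2: "t < 2" .
  have b0: "0 \<le> b" "b \<le> 2" unfolding b using q by (auto simp: field_simps)
  have "q' + b = (3 * q - 4) / (q - 1)" unfolding b q'_def by (simp add: add_divide_distrib[symmetric])
  moreover have "2 < (3 * q - 4) / (q - 1)" using q1 q by (simp add: field_simps)
  ultimately have "2 < q' + b" by simp
  with t0 have tb: "2 < t + b" by simp
  obtain C where C: "0 \<le> C" "\<And>k. k \<in> E1 \<Longrightarrow>
      (\<integral>\<^sup>+z. ennreal (norm (z - k) powr - t * max 1 (norm z) powr - b) \<partial>lebesgue) \<le> ennreal C"
    using nn_integral_shifted_kernel_bounded[of t b] t0 q'0 t2 b0 tb by fastforce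
  show ?thesis
  proof (intro exI[of _ "2 + C"] conjI ballI)
    fix r k assume r: "r \<in> Lpnu q 2" and k: "k \<in> E1"
    have [measurable]: "r \<in> borel_measurable lebesgue" by (rule Lpnu_measurable[OF r])
    let ?m = "\<lambda>z::complex. max 1 (norm z)"
    have bound: "(\<integral>\<^sup>+z. ennreal (norm (r z) * norm (z - k) powr - s) \<partial>lebesgue) \<le> ennreal ((2 + C) * l)"
      if l: "Lpnu_norm q 2 r \<le> l" "0 < l" for l
    proof -
      let ?A = "\<lambda>z. (norm (r z) / l) powr q * ?m z powr (2 * q - 4)"
      let ?B = "\<lambda>z. norm (z - k) powr - t * ?m z powr - b"
      have mA: "(\<lambda>z. ennreal (?A z)) \<in> borel_measurable lebesgue"
      proof -
        have "(\<lambda>z. ?m z powr (2 * q - 4)) \<in> borel_measurable lebesgue"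
          by (rule measurable_completion) measurable
        moreover have "(\<lambda>z. (norm (r z) / l) powr q) \<in> borel_measurable lebesgue"
          by (intro powr_real_measurable borel_measurable_divide borel_measurable_norm borel_measurable_const) measurable
        ultimately show ?thesis by (intro measurable_compose[OF borel_measurable_times measurable_ennreal])
      qed
      have mB: "(\<lambda>z. ennreal (?B z)) \<in> borel_measurable lebesgue"
        by (rule measurable_completion) measurable
      have pw: "norm (r z) * norm (z - k) powr - s \<le> l * (?A z + ?B z)" for z
      proof -
        have "norm (r z) / l * ?m z powr (2 - 4 / q) * (norm (z - k) powr - s * ?m z powr - (2 - 4 / q))
          \<le> (norm (r z) / l * ?m z powr (2 - 4 / q)) powr q + (norm (z - k) powr - s * ?m z powr - (2 - 4 / q)) powr q'"
          unfolding q'_def by (rule product_le_powr_conjugates) (use q l in auto)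
        also have "(norm (r z) / l * ?m z powr (2 - 4 / q)) powr q = ?A z"
        proof -
          have "(2 - 4 / q) * q = 2 * q - 4" using q1 by (simp add: field_simps)
          then show ?thesis using l by (subst powr_mult) (simp_all only: powr_powr)
        qed
        also have "(norm (z - k) powr - s * ?m z powr - (2 - 4 / q)) powr q' = ?B z"
          by (subst powr_mult) (simp_all only: powr_powr t_def b_def mult_minus_left)
        also have "norm (r z) / l * ?m z powr (2 - 4 / q) * (norm (z - k) powr - s * ?m z powr - (2 - 4 / q))
           = norm (r z) / l * norm (z - k) powr - s * (?m z powr (2 - 4 / q) * ?m z powr - (2 - 4 / q))"
          by (simp only: mult_ac)
        also have "?m z powr (2 - 4 / q) * ?m z powr - (2 - 4 / q) = 1"
          by (auto simp: powr_add[symmetric] max_def)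
        finally show ?thesis using l(2) by (simp add: field_simps)
      qed
      have "(\<integral>\<^sup>+z. ennreal (norm (r z) * norm (z - k) powr - s) \<partial>lebesgue)
         \<le> (\<integral>\<^sup>+z. ennreal l * (ennreal (?A z) + ennreal (?B z)) \<partial>lebesgue)"
        using l(2) by (intro nn_integral_mono)
          (simp add: ennreal_mult[symmetric] ennreal_plus[symmetric] pw del: ennreal_plus)
      also have "\<dots> = ennreal l * ((\<integral>\<^sup>+z. ennreal (?A z) \<partial>lebesgue) + (\<integral>\<^sup>+z. ennreal (?B z) \<partial>lebesgue))"
        by (simp only: nn_integral_cmult[OF borel_measurable_add[OF mA mB]] nn_integral_add[OF mA mB])
      also have "\<dots> \<le> ennreal l * (2 + ennreal C)"
        by (intro mult_left_mono add_mono Lpnu_norm_nn_integral C) (use r l q k in auto)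
      also have "\<dots> = ennreal ((2 + C) * l)"
        using C l by (simp add: ennreal_mult ennreal_plus mult.commute)
      finally show ?thesis .
    qed
    show "(\<integral>\<^sup>+z. ennreal (norm (r z) * norm (z - k) powr - s) \<partial>lebesgue) \<le> ennreal ((2 + C) * Lpnu_norm q 2 r)"
    \<comment> \<open>The norm of \<open>r\<close> may be zero, so the estimate is used with majorants slightly above it; the
      factor \<open>2 + C\<close> in the excess makes the total error exactly \<open>e\<close>.\<close>
    proof (rule ennreal_le_epsilon)
      fix e :: real assume e: "0 < e"
      let ?n = "Lpnu_norm q 2 r"
      have n0: "0 \<le> ?n" by (rule Lpnu_norm_nonneg)
      have "(\<integral>\<^sup>+z. ennreal (norm (r z) * norm (z - k) powr - s) \<partial>lebesgue) \<le> ennreal ((2 + C) * (?n + e / (2 + C)))"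
        by (rule bound) (use n0 e C in \<open>auto intro: add_nonneg_pos\<close>)
      also have "(2 + C) * (?n + e / (2 + C)) = (2 + C) * ?n + e"
        using C(1) by (simp add: distrib_left)
      also have "ennreal ((2 + C) * ?n + e) = ennreal ((2 + C) * ?n) + ennreal e"
        using C(1) n0 e by (intro ennreal_plus) auto
      finally show "(\<integral>\<^sup>+z. ennreal (norm (r z) * norm (z - k) powr - s) \<partial>lebesgue) \<le> ennreal ((2 + C) * ?n) + ennreal e" .
    qed
  qed (use C in simp)
qed

section \<open>The Cauchy transform on the disc and near infinity\<close>

text \<open>
  Say \<open>a \<le> b\<close>. Then \<open>d \<le> 2 b\<close>, so the part \<open>d powr (1 - \<alpha>)\<close> of \<open>d\<close> is at most
  \<open>2 b powr (1 - \<alpha>)\<close>; it cancels against \<open>b\<close> up to \<open>b powr -\<alpha> \<le> a powr -\<alpha>\<close>.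
\<close>

lemma difference_kernel_real:
  fixes a b d \<alpha> :: real
  assumes "0 < a" "0 < b" "0 \<le> d" "d \<le> a + b" "0 \<le> \<alpha>" "\<alpha> \<le> 1"
  shows "d / (a * b) \<le> 2 * d powr \<alpha> * (a powr - (1 + \<alpha>) + b powr - (1 + \<alpha>))"
proof -
  have le: "d / (a * b) \<le> 2 * d powr \<alpha> * a powr - (1 + \<alpha>)"
    if "0 < a" "a \<le> b" "d \<le> a + b" for a b
  proof -
    have "d = d powr \<alpha> * d powr (1 - \<alpha>)"
      using assms(3) by (simp add: powr_add[symmetric])
    also have "\<dots> \<le> d powr \<alpha> * (2 * b) powr (1 - \<alpha>)"
      using that assms by (intro mult_left_mono powr_mono2) auto
    also have "\<dots> \<le> d powr \<alpha> * (2 * b powr (1 - \<alpha>))"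
    proof -
      have "2 powr (1 - \<alpha>) \<le> 2 powr (1::real)" using assms by (intro powr_mono) auto
      then show ?thesis using that by (simp add: powr_mult mult_left_mono mult_right_mono)
    qed
    finally have "d / (a * b) \<le> d powr \<alpha> * (2 * b powr (1 - \<alpha>)) / (a * b)"
      using that by (intro divide_right_mono) auto
    also have "\<dots> = 2 * d powr \<alpha> * (a powr - 1 * b powr - \<alpha>)"
      using that by (simp add: powr_minus powr_diff field_simps)
    also have "\<dots> \<le> 2 * d powr \<alpha> * (a powr - 1 * a powr - \<alpha>)"
      using that assms by (intro mult_left_mono powr_mono2') auto
    also have "a powr - 1 * a powr - \<alpha> = a powr - (1 + \<alpha>)"
      unfolding powr_add[symmetric] by simp
    finally show ?thesis .
  qed
  have nn: "0 \<le> 2 * d powr \<alpha> * a powr - (1 + \<alpha>)" "0 \<le> 2 * d powr \<alpha> * b powr - (1 + \<alpha>)"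
    by simp_all
  have "d / (a * b) \<le> 2 * d powr \<alpha> * a powr - (1 + \<alpha>) + 2 * d powr \<alpha> * b powr - (1 + \<alpha>)"
  proof (cases "a \<le> b")
    case True
    then show ?thesis using le[OF assms(1) True assms(4)] nn(2) by linarith
  next
    case False
    then have "d / (b * a) \<le> 2 * d powr \<alpha> * b powr - (1 + \<alpha>)" using assms by (intro le) auto
    then show ?thesis using nn(1) unfolding mult.commute[of a b] by linarith
  qed
  then show ?thesis unfolding distrib_left .
qed

lemma difference_kernel:
  fixes z k1 k2 :: complex
  assumes "z \<noteq> k1" "z \<noteq> k2" "0 \<le> \<alpha>" "\<alpha> \<le> 1"
  shows "norm (1 / (z - k1) - 1 / (z - k2))
    \<le> 2 * norm (k1 - k2) powr \<alpha> * (norm (z - k1) powr - (1 + \<alpha>) + norm (z - k2) powr - (1 + \<alpha>))"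
proof -
  have "1 / (z - k1) - 1 / (z - k2) = (k1 - k2) / ((z - k1) * (z - k2))"
    using assms by (simp add: field_simps)
  then have "norm (1 / (z - k1) - 1 / (z - k2)) = norm (k1 - k2) / (norm (z - k1) * norm (z - k2))"
    by (simp add: norm_divide norm_mult)
  also have "\<dots> \<le> 2 * norm (k1 - k2) powr \<alpha> * (norm (z - k1) powr - (1 + \<alpha>) + norm (z - k2) powr - (1 + \<alpha>))"
    using norm_triangle_ineq4[of "z - k2" "z - k1"] assms
    by (intro difference_kernel_real) auto
  finally show ?thesis .
qed

lemma norm_cscale: "norm (cscale c A) = norm c * norm A"
  by (simp add: cscale_def norm_vec_def norm_mult flip: L2_set_right_distrib)

lemma cscale_diff_left: "cscale (a - b) A = cscale a A - cscale b A"
  by (simp add: cscale_def vec_eq_iff left_diff_distrib)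

text \<open>
  Written with real scalings, a scaled matrix function is a sum of products of measurable functions.
\<close>

lemma cscale_eq_scaleR: "cscale c A = Re c *\<^sub>R A + Im c *\<^sub>R cscale \<i> A"
  by (simp add: cscale_def vec_eq_iff complex_eq_iff)

lemma bounded_linear_cscale: "bounded_linear (cscale c)"
proof (rule linear_conv_bounded_linear[THEN iffD1], rule linearI)
qed (auto simp: cscale_def vec_eq_iff algebra_simps)

lemma cscale_measurable:
  assumes c: "c \<in> borel_measurable M" and F: "F \<in> borel_measurable M"
  shows "(\<lambda>z. cscale (c z) (F z)) \<in> borel_measurable M"
proof -
  have i: "cscale \<i> \<in> borel_measurable borel"
    using bounded_linear_cscale by (simp add: borel_measurable_continuous_onI linear_continuous_on)
  have "(\<lambda>z. Re (c z) *\<^sub>R F z + Im (c z) *\<^sub>R cscale \<i> (F z)) \<in> borel_measurable M"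
    by (intro borel_measurable_add borel_measurable_scaleR F measurable_compose[OF F i]
        measurable_compose[OF c borel_measurable_Re] measurable_compose[OF c borel_measurable_Im])
  then show ?thesis by (simp only: cscale_eq_scaleR[symmetric])
qed

lemma cscale_integral_bound:
  assumes c: "c \<in> borel_measurable M" and H: "H \<in> borel_measurable M" and D: "0 \<le> D"
    and le: "(\<integral>\<^sup>+z. ennreal (norm (c z) * norm (H z)) \<partial>M) \<le> ennreal D"
  shows "integrable M (\<lambda>z. cscale (c z) (H z))" and "norm (\<integral>z. cscale (c z) (H z) \<partial>M) \<le> D"
proof -
  show int: "integrable M (\<lambda>z. cscale (c z) (H z))"
  proof (rule integrableI_bounded)
    show "(\<integral>\<^sup>+z. ennreal (norm (cscale (c z) (H z))) \<partial>M) < \<infinity>"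
      using le by (simp add: norm_cscale) (metis ennreal_less_top infinity_ennreal_def order_le_less_trans)
  qed (rule cscale_measurable[OF c H])
  have "ennreal (norm (\<integral>z. cscale (c z) (H z) \<partial>M)) \<le> (\<integral>\<^sup>+z. ennreal (norm (cscale (c z) (H z))) \<partial>M)"
    by (rule integral_norm_bound_ennreal[OF int])
  also have "\<dots> \<le> ennreal D" using le by (simp add: norm_cscale)
  finally show "norm (\<integral>z. cscale (c z) (H z) \<partial>M) \<le> D" using D by simp
qed

text \<open>
  The Cauchy transform over the whole plane without its numerical factor. A half plane is encoded as a
  cut-off in \<open>H\<close>.
\<close>

definition cauchy_int :: "(complex \<Rightarrow> complex^2^2) \<Rightarrow> complex \<Rightarrow> complex^2^2" where
  "cauchy_int H k = (\<integral>z. cscale (1 / (z - k)) (H z) \<partial>lebesgue)"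

lemma cauchy_kernel_measurable: "(\<lambda>z. 1 / (z - k) :: complex) \<in> borel_measurable lebesgue"
  by (rule measurable_completion) measurable

lemma norm_powr_shift_measurable: "(\<lambda>z::complex. norm (z - k) powr s) \<in> borel_measurable lebesgue"
  by (rule measurable_completion) measurable

lemma AE_lebesgue_neq: "AE z in lebesgue. z \<noteq> (k::complex)"
  by (rule AE_completion[OF AE_lborel_singleton])

text \<open>
  Every kernel below is dominated, off finitely many points, by a multiple of two shifted powers with
  the same exponent; this lemma passes from such a pointwise bound to the integral.
\<close>

lemma potential_add_le:
  fixes h :: "complex \<Rightarrow> real"
  assumes h: "h \<in> borel_measurable lebesgue" "\<And>z. 0 \<le> h z" and D: "0 \<le> D"
    and c: "0 \<le> c"
    and 1: "(\<integral>\<^sup>+z. ennreal (h z * norm (z - k1) powr - s) \<partial>lebesgue) \<le> ennreal D"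
    and 2: "(\<integral>\<^sup>+z. ennreal (h z * norm (z - k2) powr - s) \<partial>lebesgue) \<le> ennreal D"
    and g: "AE z in lebesgue. g z \<le> c * (norm (z - k1) powr - s + norm (z - k2) powr - s) * h z"
  shows "(\<integral>\<^sup>+z. ennreal (g z) \<partial>lebesgue) \<le> ennreal (2 * c * D)"
proof -
  have m: "(\<lambda>z. ennreal (h z * norm (z - k) powr - s)) \<in> borel_measurable lebesgue" for k
    by (intro measurable_compose[OF borel_measurable_times measurable_ennreal] h norm_powr_shift_measurable)
  have "(\<integral>\<^sup>+z. ennreal (g z) \<partial>lebesgue)
    \<le> (\<integral>\<^sup>+z. ennreal c * (ennreal (h z * norm (z - k1) powr - s) + ennreal (h z * norm (z - k2) powr - s)) \<partial>lebesgue)"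
  proof (rule nn_integral_mono_AE)
    show "AE z in lebesgue. ennreal (g z)
      \<le> ennreal c * (ennreal (h z * norm (z - k1) powr - s) + ennreal (h z * norm (z - k2) powr - s))"
      using g
    proof eventually_elim
      case (elim z)
      then have "ennreal (g z) \<le> ennreal (c * (h z * norm (z - k1) powr - s + h z * norm (z - k2) powr - s))"
        by (intro ennreal_leI) (simp add: algebra_simps)
      also have "\<dots> = ennreal c * (ennreal (h z * norm (z - k1) powr - s) + ennreal (h z * norm (z - k2) powr - s))"
        using h(2)[of z] c by (simp add: ennreal_mult ennreal_plus)
      finally show ?case .
    qed
  qed
  also have "\<dots> = ennreal c * ((\<integral>\<^sup>+z. ennreal (h z * norm (z - k1) powr - s) \<partial>lebesgue)
      + (\<integral>\<^sup>+z. ennreal (h z * norm (z - k2) powr - s) \<partial>lebesgue))"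
    by (simp only: nn_integral_cmult[OF borel_measurable_add[OF m m]] nn_integral_add[OF m m])
  also have "\<dots> \<le> ennreal c * (ennreal D + ennreal D)"
    by (intro mult_left_mono add_mono 1 2) auto
  also have "\<dots> = ennreal (2 * c * D)"
    using D c by (simp add: ennreal_mult[symmetric] ennreal_plus[symmetric] del: ennreal_plus)
  finally show ?thesis .
qed

lemma cauchy_int_diff:
  assumes "integrable lebesgue (\<lambda>z. cscale (1 / (z - k1)) (H z))"
    and "integrable lebesgue (\<lambda>z. cscale (1 / (z - k2)) (H z))"
  shows "cauchy_int H k1 - cauchy_int H k2 = (\<integral>z. cscale (1 / (z - k1) - 1 / (z - k2)) (H z) \<partial>lebesgue)"
  unfolding cauchy_int_def cscale_diff_left by (rule Bochner_Integration.integral_diff[OF assms, symmetric])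

lemma cauchy_int_disc:
  assumes H: "H \<in> borel_measurable lebesgue" and D: "0 \<le> D" and \<alpha>: "0 \<le> \<alpha>" "\<alpha> \<le> 1"
    and pot: "\<And>k s. k \<in> E1 \<Longrightarrow> s \<in> {1, 1 + \<alpha>} \<Longrightarrow>
      (\<integral>\<^sup>+z. ennreal (norm (H z) * norm (z - k) powr - s) \<partial>lebesgue) \<le> ennreal D"
  shows "k \<in> E1 \<Longrightarrow> norm (cauchy_int H k) \<le> D"
    and "k1 \<in> E1 \<Longrightarrow> k2 \<in> E1 \<Longrightarrow>
      norm (cauchy_int H k1 - cauchy_int H k2) \<le> 4 * D * norm (k1 - k2) powr \<alpha>"
proof -
  have le: "(\<integral>\<^sup>+z. ennreal (norm (1 / (z - k)) * norm (H z)) \<partial>lebesgue) \<le> ennreal D" if "k \<in> E1" for k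
    using pot[OF that, of 1] by (simp add: norm_divide powr_minus_divide mult.commute)
  note b = cscale_integral_bound[OF cauchy_kernel_measurable H D le]
  show "norm (cauchy_int H k) \<le> D" if "k \<in> E1" using b(2)[OF that] by (simp add: cauchy_int_def)
  assume k: "k1 \<in> E1" "k2 \<in> E1"
  let ?c = "2 * norm (k1 - k2) powr \<alpha>"
  have "(\<integral>\<^sup>+z. ennreal (norm (1 / (z - k1) - 1 / (z - k2)) * norm (H z)) \<partial>lebesgue) \<le> ennreal (2 * ?c * D)"
  proof (rule potential_add_le[where h = "\<lambda>z. norm (H z)" and s = "1 + \<alpha>"])
    show "AE z in lebesgue. norm (1 / (z - k1) - 1 / (z - k2)) * norm (H z)
      \<le> ?c * (norm (z - k1) powr - (1 + \<alpha>) + norm (z - k2) powr - (1 + \<alpha>)) * norm (H z)"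
      using AE_lebesgue_neq[of k1] AE_lebesgue_neq[of k2]
      by eventually_elim (intro mult_right_mono difference_kernel \<alpha>, auto)
  qed (use k pot[of k1 "1 + \<alpha>"] pot[of k2 "1 + \<alpha>"] D H in auto)
  from cscale_integral_bound(2)[OF borel_measurable_diff[OF cauchy_kernel_measurable cauchy_kernel_measurable] H _ this] D
  show "norm (cauchy_int H k1 - cauchy_int H k2) \<le> 4 * D * norm (k1 - k2) powr \<alpha>"
    by (simp add: cauchy_int_diff[OF b(1)[OF k(1)] b(1)[OF k(2)]] mult_ac)
qed

text \<open>
  The Jacobian \<open>|z| powr -4\<close> is split evenly: one half belongs to the kernel, the other to the density,
  which thereby becomes dominated by a weighted inversion.
\<close>

lemma nn_integral_inverse_kernel:
  fixes c :: "complex \<Rightarrow> complex" and H :: "complex \<Rightarrow> complex^2^2"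
  assumes c: "c \<in> borel_measurable lebesgue" and H: "H \<in> borel_measurable lebesgue"
  shows "(\<integral>\<^sup>+z. ennreal (norm (c z) * norm (H z)) \<partial>lebesgue)
    = (\<integral>\<^sup>+z. ennreal (norm z powr - 2 * norm (c (inverse z)) * (norm z powr - 2 * norm (H (inverse z)))) \<partial>lebesgue)"
proof -
  have "(\<integral>\<^sup>+z. ennreal (norm (c z) * norm (H z)) \<partial>lebesgue)
    = (\<integral>\<^sup>+z. ennreal (norm z powr - 4) * ennreal (norm (c (inverse z)) * norm (H (inverse z))) \<partial>lebesgue)"
    by (rule nn_integral_inverse[where f = "\<lambda>z. ennreal (norm (c z) * norm (H z))"])
       (intro measurable_compose[OF borel_measurable_times measurable_ennreal] measurable_compose[OF c borel_measurable_norm]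
         measurable_compose[OF H borel_measurable_norm])
  also have "\<dots> = (\<integral>\<^sup>+z. ennreal (norm z powr - 2 * norm (c (inverse z)) * (norm z powr - 2 * norm (H (inverse z)))) \<partial>lebesgue)"
  proof (rule nn_integral_cong)
    fix z :: complex
    have "norm z powr - 4 = norm z powr - 2 * norm z powr - 2" by (simp add: powr_add[symmetric])
    then show "ennreal (norm z powr - 4) * ennreal (norm (c (inverse z)) * norm (H (inverse z)))
      = ennreal (norm z powr - 2 * norm (c (inverse z)) * (norm z powr - 2 * norm (H (inverse z))))"
      by (simp add: ennreal_mult[symmetric] mult_ac)
  qed
  finally show ?thesis .
qed

text \<open>
  After the substitution the kernel at \<open>1/k\<close> becomes \<open>|k| / (|z| |z - k|) \<le> 1/|z - k| + 1/|z|\<close>, a sum of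
  kernels at the two points \<open>k\<close> and \<open>0\<close> of the disc, and the difference of the kernels at \<open>1/k\<^sub>1\<close> and
  \<open>1/k\<^sub>2\<close> becomes exactly the difference of the kernels at \<open>k\<^sub>1\<close> and \<open>k\<^sub>2\<close>. So the same potentials
  as on the disc suffice, now for the inverted density.
\<close>

lemma cauchy_int_inverse:
  assumes H: "H \<in> borel_measurable lebesgue" and D: "0 \<le> D" and \<alpha>: "0 \<le> \<alpha>" "\<alpha> \<le> 1"
    and pot: "\<And>k s. k \<in> E1 \<Longrightarrow> s \<in> {1, 1 + \<alpha>} \<Longrightarrow>
      (\<integral>\<^sup>+z. ennreal (norm z powr - 2 * norm (H (inverse z)) * norm (z - k) powr - s) \<partial>lebesgue) \<le> ennreal D"
  shows "k \<in> E1 - {0} \<Longrightarrow> norm (cauchy_int H (inverse k)) \<le> 2 * D"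
    and "k1 \<in> E1 - {0} \<Longrightarrow> k2 \<in> E1 - {0} \<Longrightarrow>
      norm (cauchy_int H (inverse k1) - cauchy_int H (inverse k2)) \<le> 4 * D * norm (k1 - k2) powr \<alpha>"
proof -
  let ?h = "\<lambda>z. norm z powr - 2 * norm (H (inverse z))"
  have hm: "?h \<in> borel_measurable lebesgue"
    using norm_powr_shift_measurable[of 0 "-2"]
    by (intro borel_measurable_times measurable_compose[OF measurable_compose[OF inverse_lebesgue H] borel_measurable_norm]) simp
  have zk: "1 / (inverse z - inverse k) = z * k / (k - z)" if "z \<noteq> 0" "k \<noteq> 0" "z \<noteq> k" for z k :: complex
    using that by (simp add: field_simps)
  have le: "(\<integral>\<^sup>+z. ennreal (norm (1 / (z - inverse k)) * norm (H z)) \<partial>lebesgue) \<le> ennreal (2 * 1 * D)" if k: "k \<in> E1 - {0}" for k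
    unfolding nn_integral_inverse_kernel[OF cauchy_kernel_measurable H]
  proof (rule potential_add_le[where h = ?h and s = 1])
    show "AE z in lebesgue. norm z powr - 2 * norm (1 / (inverse z - inverse k)) * ?h z
        \<le> 1 * (norm (z - k) powr - 1 + norm (z - 0) powr - 1) * ?h z"
      using AE_lebesgue_neq[of k] AE_lebesgue_neq[of 0]
    proof eventually_elim
      case (elim z)
      have "norm k \<le> norm z + norm (z - k)" using norm_triangle_ineq4[of z "z - k"] by simp
      then have "norm k / (norm z * norm (z - k)) \<le> 1 / norm (z - k) + 1 / norm z"
        using elim by (simp add: field_simps)
      moreover have "norm z powr - 2 * norm (1 / (inverse z - inverse k)) = norm k / (norm z * norm (z - k))"
        using elim k by (simp add: zk norm_divide norm_mult norm_minus_commute powr_minus field_simps power2_eq_square)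
      ultimately have "norm z powr - 2 * norm (1 / (inverse z - inverse k)) \<le> 1 * (norm (z - k) powr - 1 + norm (z - 0) powr - 1)"
        by (simp add: powr_minus_divide)
      then show ?case by (rule mult_right_mono) simp
    qed
  qed (use k pot[of k 1] pot[of 0 1] D hm in \<open>auto simp: E1_def\<close>)
  note b = cscale_integral_bound[OF cauchy_kernel_measurable H _ le]
  show "norm (cauchy_int H (inverse k)) \<le> 2 * D" if "k \<in> E1 - {0}" using b(2)[OF _ that] D by (simp add: cauchy_int_def)
  assume k: "k1 \<in> E1 - {0}" "k2 \<in> E1 - {0}"
  let ?c = "2 * norm (k1 - k2) powr \<alpha>"
  have "(\<integral>\<^sup>+z. ennreal (norm (1 / (z - inverse k1) - 1 / (z - inverse k2)) * norm (H z)) \<partial>lebesgue) \<le> ennreal (2 * ?c * D)"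
    unfolding nn_integral_inverse_kernel[OF borel_measurable_diff[OF cauchy_kernel_measurable cauchy_kernel_measurable] H]
  proof (rule potential_add_le[where h = ?h and s = "1 + \<alpha>"])
    show "AE z in lebesgue. norm z powr - 2 * norm (1 / (inverse z - inverse k1) - 1 / (inverse z - inverse k2)) * ?h z
      \<le> ?c * (norm (z - k1) powr - (1 + \<alpha>) + norm (z - k2) powr - (1 + \<alpha>)) * ?h z"
      using AE_lebesgue_neq[of k1] AE_lebesgue_neq[of k2] AE_lebesgue_neq[of 0]
    proof eventually_elim
      case (elim z)
      have "1 / (inverse z - inverse k1) - 1 / (inverse z - inverse k2) = - (z^2) * (1 / (z - k1) - 1 / (z - k2))"
      proof -
        have "z * k / (k - z) = z - z^2 * (1 / (z - k))" if "z \<noteq> k" for k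
          using that by (simp add: divide_simps) (simp add: power2_eq_square algebra_simps)
        then show ?thesis using elim k by (simp add: zk right_diff_distrib)
      qed
      then have "norm z powr - 2 * norm (1 / (inverse z - inverse k1) - 1 / (inverse z - inverse k2)) = norm (1 / (z - k1) - 1 / (z - k2))"
        using elim by (simp add: norm_mult norm_power powr_minus)
      also have "\<dots> \<le> ?c * (norm (z - k1) powr - (1 + \<alpha>) + norm (z - k2) powr - (1 + \<alpha>))"
        using elim \<alpha> by (intro difference_kernel) auto
      finally show ?case by (rule mult_right_mono) simp
    qed
  qed (use k pot[of k1 "1 + \<alpha>"] pot[of k2 "1 + \<alpha>"] D hm in auto)
  from cscale_integral_bound(2)[OF borel_measurable_diff[OF cauchy_kernel_measurable cauchy_kernel_measurable] H _ this] D
  show "norm (cauchy_int H (inverse k1) - cauchy_int H (inverse k2)) \<le> 4 * D * norm (k1 - k2) powr \<alpha>"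
    using D by (simp add: cauchy_int_diff[OF b(1)[OF _ k(1)] b(1)[OF _ k(2)]] mult_ac)
qed

text \<open>
  One number bounds all four suprema in the norm of \<open>C\<^sup>\<alpha>\<close> of the plane, measured in the Euclidean
  norm of matrices. Unlike the norm itself, this predicate makes additivity and scaling immediate.
\<close>

definition sphere_hoelder_bound :: "real \<Rightarrow> real \<Rightarrow> (complex \<Rightarrow> complex^2^2) \<Rightarrow> bool" where
  "sphere_hoelder_bound \<alpha> D f \<longleftrightarrow>
     (\<forall>k\<in>E1. norm (f k) \<le> D) \<and>
     (\<forall>k1\<in>E1. \<forall>k2\<in>E1. norm (f k1 - f k2) \<le> D * norm (k1 - k2) powr \<alpha>) \<and>
     (\<forall>k\<in>E1 - {0}. norm (f (inverse k)) \<le> D) \<and>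
     (\<forall>k1\<in>E1 - {0}. \<forall>k2\<in>E1 - {0}. norm (f (inverse k1) - f (inverse k2)) \<le> D * norm (k1 - k2) powr \<alpha>)"

lemma sphere_hoelder_bound_zero: "sphere_hoelder_bound \<alpha> 0 (\<lambda>k. 0)"
  by (simp add: sphere_hoelder_bound_def)

lemma sphere_hoelder_bound_add:
  assumes "sphere_hoelder_bound \<alpha> D f" "sphere_hoelder_bound \<alpha> D' g"
  shows "sphere_hoelder_bound \<alpha> (D + D') (\<lambda>k. f k + g k)"
proof -
  have a: "norm (a + b) \<le> D + D'" if "norm a \<le> D" "norm b \<le> D'" for a b :: "complex^2^2"
    using norm_triangle_mono[OF that] .
  have d: "norm (a + b - (a' + b')) \<le> (D + D') * t" if "norm (a - a') \<le> D * t" "norm (b - b') \<le> D' * t"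
    for a b a' b' :: "complex^2^2" and t
    using norm_triangle_mono[OF that] by (simp add: algebra_simps)
  show ?thesis using assms unfolding sphere_hoelder_bound_def by (intro conjI ballI a d) auto
qed

lemma sphere_hoelder_bound_cscale:
  assumes "sphere_hoelder_bound \<alpha> D f" "norm c \<le> 1"
  shows "sphere_hoelder_bound \<alpha> D (\<lambda>k. cscale c (f k))"
proof -
  have 1: "norm (cscale c A) \<le> t" if "norm A \<le> t" for A t
    using mult_mono[OF assms(2) that] by (simp add: norm_cscale)
  have 2: "norm (cscale c A - cscale c A') \<le> t" if "norm (A - A') \<le> t" for A A' t
    using 1[OF that] by (simp add: linear_diff[OF bounded_linear.linear[OF bounded_linear_cscale]])
  show ?thesis using assms(1) unfolding sphere_hoelder_bound_def by (intro conjI ballI 1 2) auto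
qed

lemma sphere_hoelder_bound_mono:
  assumes "sphere_hoelder_bound \<alpha> D f" "D \<le> D'"
  shows "sphere_hoelder_bound \<alpha> D' f"
proof -
  have "D * norm (k1 - k2) powr \<alpha> \<le> D' * norm (k1 - k2) powr \<alpha>" for k1 k2 :: complex
    using assms(2) by (intro mult_right_mono) auto
  then show ?thesis using assms unfolding sphere_hoelder_bound_def by (meson order_trans)
qed

lemma potential_dominated:
  assumes r: "r \<in> Lpnu q 2" and B: "0 \<le> B" and h: "\<And>z. h z \<le> B * norm (r z)"
    and C: "0 \<le> C" and pot: "(\<integral>\<^sup>+z. ennreal (norm (r z) * norm (z - k) powr - s) \<partial>lebesgue) \<le> ennreal (C * Lpnu_norm q 2 r)"
  shows "(\<integral>\<^sup>+z. ennreal (h z * norm (z - k) powr - s) \<partial>lebesgue) \<le> ennreal (C * B * Lpnu_norm q 2 r)"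
proof -
  have "(\<integral>\<^sup>+z. ennreal (h z * norm (z - k) powr - s) \<partial>lebesgue)
    \<le> (\<integral>\<^sup>+z. ennreal B * ennreal (norm (r z) * norm (z - k) powr - s) \<partial>lebesgue)"
  proof (rule nn_integral_mono)
    fix z
    have "h z * norm (z - k) powr - s \<le> B * norm (r z) * norm (z - k) powr - s"
      by (intro mult_right_mono h) auto
    then show "ennreal (h z * norm (z - k) powr - s) \<le> ennreal B * ennreal (norm (r z) * norm (z - k) powr - s)"
      using B by (simp add: ennreal_mult[symmetric] ennreal_leI mult.assoc)
  qed
  also have "\<dots> = ennreal B * (\<integral>\<^sup>+z. ennreal (norm (r z) * norm (z - k) powr - s) \<partial>lebesgue)"
    by (rule nn_integral_cmult) (intro measurable_compose[OF borel_measurable_times measurable_ennreal]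
        measurable_compose[OF Lpnu_measurable[OF r] borel_measurable_norm] norm_powr_shift_measurable)
  also have "\<dots> \<le> ennreal B * ennreal (C * Lpnu_norm q 2 r)"
    by (intro mult_left_mono pot) simp
  also have "\<dots> = ennreal (C * B * Lpnu_norm q 2 r)"
    using B C Lpnu_norm_nonneg by (simp add: ennreal_mult[symmetric] mult_ac)
  finally show ?thesis .
qed

text \<open>
  The potentials with \<open>s = 1\<close> and \<open>s = 1 + \<alpha>\<close> are bounded for \<open>r\<close> and, since weighted inversion
  preserves the norm, for its weighted inversion with the same constant.
\<close>

lemma cauchy_int_hoelder:
  assumes q: "2 < q" and \<alpha>: "0 < \<alpha>" "\<alpha> < 1 - 2 / q"
  shows "\<exists>M>0. \<forall>r\<in>Lpnu q 2. \<forall>H\<in>borel_measurable lebesgue. \<forall>B\<ge>0.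
    (\<forall>z. norm (H z) \<le> B * norm (r z)) \<longrightarrow>
    sphere_hoelder_bound \<alpha> (M * B * Lpnu_norm q 2 r) (cauchy_int H)"
proof -
  have \<alpha>1: "0 \<le> \<alpha>" "\<alpha> \<le> 1" using \<alpha> q by (auto intro: order_trans[OF less_imp_le[OF \<alpha>(2)]])
  have q2: "1 < 2 - 2 / q" using q by (simp add: field_simps)
  obtain C1 where C1: "C1 > 0" "\<And>r k. r \<in> Lpnu q 2 \<Longrightarrow> k \<in> E1 \<Longrightarrow>
     (\<integral>\<^sup>+z. ennreal (norm (r z) * norm (z - k) powr - 1) \<partial>lebesgue) \<le> ennreal (C1 * Lpnu_norm q 2 r)"
    using Lpnu_potential_bounded[OF q order_refl q2] by blast
  obtain C2 where C2: "C2 > 0" "\<And>r k. r \<in> Lpnu q 2 \<Longrightarrow> k \<in> E1 \<Longrightarrow>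
     (\<integral>\<^sup>+z. ennreal (norm (r z) * norm (z - k) powr - (1 + \<alpha>)) \<partial>lebesgue) \<le> ennreal (C2 * Lpnu_norm q 2 r)"
    using Lpnu_potential_bounded[OF q, of "1 + \<alpha>"] \<alpha> by fastforce
  define C where "C = max C1 C2"
  have C0: "0 < C" using C1 by (simp add: C_def)
  have pot: "(\<integral>\<^sup>+z. ennreal (norm (r z) * norm (z - k) powr - s) \<partial>lebesgue) \<le> ennreal (C * Lpnu_norm q 2 r)"
    if "r \<in> Lpnu q 2" "k \<in> E1" "s \<in> {1, 1 + \<alpha>}" for r k s
  proof -
    have "ennreal (C1 * Lpnu_norm q 2 r) \<le> ennreal (C * Lpnu_norm q 2 r)"
      "ennreal (C2 * Lpnu_norm q 2 r) \<le> ennreal (C * Lpnu_norm q 2 r)"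
      by (intro ennreal_leI mult_right_mono Lpnu_norm_nonneg, simp add: C_def)+
    then show ?thesis using that C1(2)[OF that(1,2)] C2(2)[OF that(1,2)] by (auto intro: order_trans)
  qed
  show ?thesis
  proof (intro exI[of _ "4 * C"] conjI ballI allI impI)
    fix r B and H :: "complex \<Rightarrow> complex^2^2"
    assume r: "r \<in> Lpnu q 2" and H: "H \<in> borel_measurable lebesgue" and B: "0 \<le> B"
      and le: "\<forall>z. norm (H z) \<le> B * norm (r z)"
    define D where "D = C * B * Lpnu_norm q 2 r"
    have D: "0 \<le> D" using C0 B Lpnu_norm_nonneg by (simp add: D_def)
    let ?g = "weighted_inversion 2 r"
    have p1: "(\<integral>\<^sup>+z. ennreal (norm (H z) * norm (z - k) powr - s) \<partial>lebesgue) \<le> ennreal D"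
      if "k \<in> E1" "s \<in> {1, 1 + \<alpha>}" for k s
      unfolding D_def by (rule potential_dominated[OF r B _ _ pot[OF r that]]) (use le C0 in auto)
    have p2: "(\<integral>\<^sup>+z. ennreal (norm z powr - 2 * norm (H (inverse z)) * norm (z - k) powr - s) \<partial>lebesgue) \<le> ennreal D"
      if "k \<in> E1" "s \<in> {1, 1 + \<alpha>}" for k s
      unfolding D_def weighted_inversion_Lpnu(2)[OF r, symmetric]
    proof (rule potential_dominated[OF weighted_inversion_Lpnu(1)[OF r] B _ _ pot[OF weighted_inversion_Lpnu(1)[OF r] that]])
      fix z
      have "norm z powr - 2 * norm (H (inverse z)) \<le> norm z powr - 2 * (B * norm (r (inverse z)))"
        using le by (intro mult_left_mono) auto
      then show "norm z powr - 2 * norm (H (inverse z)) \<le> B * norm (?g z)"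
        by (simp add: weighted_inversion_def norm_mult mult.left_commute)
    qed (use C0 in simp)
    have disc: "norm (cauchy_int H k) \<le> D"
        "norm (cauchy_int H k1 - cauchy_int H k2) \<le> 4 * D * norm (k1 - k2) powr \<alpha>"
      if "k \<in> E1" "k1 \<in> E1" "k2 \<in> E1" for k k1 k2
      by (rule cauchy_int_disc[OF H D \<alpha>1]; use p1 that in blast)+
    have inv: "norm (cauchy_int H (inverse k)) \<le> 2 * D"
        "norm (cauchy_int H (inverse k1) - cauchy_int H (inverse k2)) \<le> 4 * D * norm (k1 - k2) powr \<alpha>"
      if "k \<in> E1 - {0}" "k1 \<in> E1 - {0}" "k2 \<in> E1 - {0}" for k k1 k2
      by (rule cauchy_int_inverse[OF H D \<alpha>1]; use p2 that in blast)+
    have "sphere_hoelder_bound \<alpha> (4 * D) (cauchy_int H)"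
      unfolding sphere_hoelder_bound_def
    proof (intro conjI ballI)
      show "norm (cauchy_int H k) \<le> 4 * D" if "k \<in> E1" for k
        using disc(1)[OF that that that] D by simp
      show "norm (cauchy_int H (inverse k)) \<le> 4 * D" if "k \<in> E1 - {0}" for k
        using inv(1)[OF that that that] D by simp
    qed (use disc(2) inv(2) in blast)+
    then show "sphere_hoelder_bound \<alpha> (4 * C * B * Lpnu_norm q 2 r) (cauchy_int H)"
      by (simp add: D_def mult.assoc)
  qed (use C0 in simp)
qed

section \<open>The operator with exponential factors\<close>

lemma cauchy_T_eq_cauchy_int:
  "cauchy_T G F k = cscale (1 / (2 * of_real pi * \<i>)) (cauchy_int (\<lambda>z. cscale (- 2 * \<i> * indicator G z) (F z)) k)"
proof -
  have "indicator G z *\<^sub>R cscale (- 2 * \<i>) (cscale (1 / (z - k)) (F z))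
     = cscale (1 / (z - k)) (cscale (- 2 * \<i> * indicator G z) (F z))" for z
    by (auto simp: indicator_def cscale_def vec_eq_iff)
  then show ?thesis by (simp add: cauchy_T_def cauchy_int_def set_lebesgue_integral_def)
qed

lemma matrix_mult_right_bounded_linear: "bounded_linear (\<lambda>A :: complex^2^2. A ** (E :: complex^2^2))"
proof (rule linear_conv_bounded_linear[THEN iffD1], rule linearI)
  show "(a + b) ** E = a ** E + b ** E" for a b :: "complex^2^2"
    by (simp add: matrix_matrix_mult_def vec_eq_iff distrib_right sum.distrib)
  show "(r *\<^sub>R a) ** E = r *\<^sub>R (a ** E)" for r and a :: "complex^2^2"
    by (simp add: matrix_matrix_mult_def vec_eq_iff scaleR_sum_right)
qed

text \<open>
  Both factors \<open>w\<^sub>-\<close> and \<open>w\<^sub>+\<close> have this shape: \<open>E\<close> is a matrix unit, and \<open>e\<close> is the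
  exponential, which is bounded on the half plane \<open>G\<close> but not on the plane.
\<close>

lemma cauchy_T_hoelder:
  assumes q: "2 < q" and \<alpha>: "0 < \<alpha>" "\<alpha> < 1 - 2 / q"
  obtains M where "M > 0" and "\<And>r G \<psi> e E B. r \<in> Lpnu q 2 \<Longrightarrow> G \<in> sets borel \<Longrightarrow> B \<ge> 0 \<Longrightarrow>
    continuous_on UNIV \<psi> \<Longrightarrow> continuous_on UNIV e \<Longrightarrow> (\<And>A :: complex^2^2. norm (A ** E) \<le> norm A) \<Longrightarrow>
    (\<And>z. norm (\<psi> z) \<le> B) \<Longrightarrow> (\<And>z. z \<in> G \<Longrightarrow> norm (e z) \<le> 1) \<Longrightarrow>
    sphere_hoelder_bound \<alpha> (M * B * Lpnu_norm q 2 r) (cauchy_T G (\<lambda>z. \<psi> z ** cscale (r z * e z) E))"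
proof -
  obtain M where M: "M > 0" "\<And>r H B. r \<in> Lpnu q 2 \<Longrightarrow> H \<in> borel_measurable lebesgue \<Longrightarrow> B \<ge> 0 \<Longrightarrow>
    (\<And>z. norm (H z) \<le> B * norm (r z)) \<Longrightarrow> sphere_hoelder_bound \<alpha> (M * B * Lpnu_norm q 2 r) (cauchy_int H)"
    using cauchy_int_hoelder[OF assms] by blast
  show thesis
  proof (rule that[of "2 * M"], goal_cases)
    case (2 r G \<psi> e E B)
    let ?H = "\<lambda>z. cscale (- 2 * \<i> * indicator G z) (\<psi> z ** cscale (r z * e z) E)"
    have eq: "?H z = cscale (- 2 * \<i> * indicator G z * (r z * e z)) (\<psi> z ** E)" for z
      by (simp add: cscale_def matrix_matrix_mult_def vec_eq_iff sum_distrib_left sum_negf mult_ac)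
    have "(\<lambda>A :: complex^2^2. A ** E) \<in> borel_measurable borel"
      using matrix_mult_right_bounded_linear by (simp add: borel_measurable_continuous_onI linear_continuous_on)
    moreover have "\<psi> \<in> borel_measurable lebesgue"
      using 2 by (intro measurable_completion) (simp add: borel_measurable_continuous_onI)
    ultimately have mE: "(\<lambda>z. \<psi> z ** E) \<in> borel_measurable lebesgue"
      by (rule measurable_compose[rotated])
    have me: "e \<in> borel_measurable lebesgue"
      using 2 by (intro measurable_completion) (simp add: borel_measurable_continuous_onI)
    have mG: "(indicator G :: complex \<Rightarrow> complex) \<in> borel_measurable lebesgue"
      using 2 by (intro measurable_completion borel_measurable_indicator) simp
    have H: "?H \<in> borel_measurable lebesgue"
      unfolding eq
      by (intro cscale_measurable borel_measurable_times borel_measurable_const mE mG me Lpnu_measurable[OF 2(1)])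
    have "norm (?H z) \<le> 2 * B * norm (r z)" for z
    proof (cases "z \<in> G")
      case True
      have "norm (\<psi> z ** E) \<le> B" using 2 by (metis order_trans)
      moreover have "norm (e z) \<le> 1" using 2 True by blast
      ultimately have "norm (e z) * norm (\<psi> z ** E) \<le> 1 * B" by (intro mult_mono) auto
      then have "2 * norm (r z) * (norm (e z) * norm (\<psi> z ** E)) \<le> 2 * norm (r z) * (1 * B)"
        by (intro mult_left_mono) auto
      then show ?thesis unfolding eq using True by (simp add: norm_cscale norm_mult mult_ac)
    next
      case False
      then show ?thesis unfolding eq using 2 by (simp add: norm_cscale)
    qed
    from M(2)[OF 2(1) H _ this] 2
    have "sphere_hoelder_bound \<alpha> (M * (2 * B) * Lpnu_norm q 2 r) (cauchy_int ?H)" by simp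
    moreover have "norm (1 / (2 * of_real pi * \<i>)) \<le> 1"
      using pi_gt3 by (simp add: norm_divide norm_mult)
    ultimately have "sphere_hoelder_bound \<alpha> (M * (2 * B) * Lpnu_norm q 2 r)
       (\<lambda>k. cscale (1 / (2 * of_real pi * \<i>)) (cauchy_int ?H k))"
      by (rule sphere_hoelder_bound_cscale)
    then show ?case
      unfolding cauchy_T_eq_cauchy_int[abs_def] by (simp add: mult_ac)
  qed (use M in simp)
qed

section \<open>Norms of matrices and of Hoelder functions\<close>

text \<open>
  Expansion in matrix units bounds \<open>N\<close> by the Euclidean norm and makes it Lipschitz; its minimum over
  the compact unit sphere is positive, and homogeneity gives the reverse bound.
\<close>

lemma matrix_norm_equivalent:
  assumes N: "is_matrix_norm N"
  shows "\<exists>K>0. \<forall>A. N A \<le> K * norm A \<and> norm A \<le> K * N A"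
proof -
  have nn: "0 \<le> N A" and N0: "N A = 0 \<longleftrightarrow> A = 0" and sc: "N (cscale c A) = norm c * N A"
    and tri: "N (A + B) \<le> N A + N B" for c A B
    using N by (auto simp: is_matrix_norm_def)
  define U where "U i j = ((\<chi> a b. if a = i \<and> b = j then 1 else 0) :: complex^2^2)" for i j :: 2
  define K1 where "K1 = 1 + (\<Sum>i\<in>UNIV. \<Sum>j\<in>UNIV. N (U i j))"
  have K1: "0 < K1" unfolding K1_def using nn by (auto intro!: add_pos_nonneg sum_nonneg)
  have up: "N A \<le> K1 * norm A" for A
  proof -
    have entry: "norm (A $ i $ j) \<le> norm A" for i j
      by (rule order_trans[OF Finite_Cartesian_Product.norm_nth_le Finite_Cartesian_Product.norm_nth_le])
    have "A = (cscale (A$1$1) (U 1 1) + cscale (A$1$2) (U 1 2)) + (cscale (A$2$1) (U 2 1) + cscale (A$2$2) (U 2 2))"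
      by (simp add: vec_eq_iff forall_2 cscale_def U_def)
    from arg_cong[OF this, of N]
    have "N A \<le> N (cscale (A$1$1) (U 1 1) + cscale (A$1$2) (U 1 2)) + N (cscale (A$2$1) (U 2 1) + cscale (A$2$2) (U 2 2))"
      using tri by simp
    also have "\<dots> \<le> (N (cscale (A$1$1) (U 1 1)) + N (cscale (A$1$2) (U 1 2))) + (N (cscale (A$2$1) (U 2 1)) + N (cscale (A$2$2) (U 2 2)))"
      by (intro add_mono tri)
    also have "\<dots> \<le> (norm A * N (U 1 1) + norm A * N (U 1 2)) + (norm A * N (U 2 1) + norm A * N (U 2 2))"
      unfolding sc by (intro add_mono mult_right_mono nn entry)
    also have "\<dots> \<le> K1 * norm A"
      unfolding K1_def by (simp add: UNIV_2 algebra_simps)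
    finally show ?thesis .
  qed
  have minus: "N (A - B) = N (B - A)" for A B
  proof -
    have "cscale (- 1) (A - B) = B - A" by (simp add: cscale_def vec_eq_iff)
    then show ?thesis using sc[of "-1" "A - B"] by simp
  qed
  have lip: "\<bar>N A - N B\<bar> \<le> K1 * norm (A - B)" for A B
    using tri[of "A - B" B] tri[of "B - A" A] up[of "A - B"] minus[of A B] by simp
  have "K1-lipschitz_on UNIV N"
    by (rule lipschitz_onI) (use lip K1 in \<open>auto simp: dist_norm\<close>)
  then have "continuous_on (sphere 0 1) N"
    using continuous_on_subset lipschitz_on_continuous_on by blast
  moreover have "sphere (0 :: complex^2^2) 1 \<noteq> {}" by simp
  ultimately obtain A0 where A0: "A0 \<in> sphere 0 1" "\<And>A. A \<in> sphere 0 1 \<Longrightarrow> N A0 \<le> N A"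
    using continuous_attains_inf[OF compact_sphere] by metis
  define m where "m = N A0"
  have m: "0 < m" using A0(1) nn[of A0] N0[of A0] by (auto simp: m_def less_le)
  have low: "norm A \<le> (1 / m) * N A" for A
  proof (cases "A = 0")
    case False
    have "m \<le> N (cscale (of_real (1 / norm A)) A)"
      unfolding m_def by (rule A0(2)) (use False in \<open>simp add: norm_cscale norm_divide\<close>)
    also have "\<dots> = N A / norm A" by (simp add: sc norm_divide)
    finally show ?thesis using m False by (simp add: field_simps)
  qed (use m nn in simp)
  show ?thesis
  proof (intro exI[of _ "max K1 (1 / m)"] conjI allI)
    show "0 < max K1 (1 / m)" using K1 by simp
    show "N A \<le> max K1 (1 / m) * norm A" for A
      by (rule order_trans[OF up mult_right_mono]) auto
    show "norm A \<le> max K1 (1 / m) * N A" for A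
      by (rule order_trans[OF low mult_right_mono]) (auto simp: nn)
  qed
qed

lemma hoelder_norm_on_leD:
  assumes "hoelder_norm_on N \<alpha> S f \<le> ennreal B" "0 \<le> B"
  shows "k \<in> S \<Longrightarrow> N (f k) \<le> B"
    and "k1 \<in> S \<Longrightarrow> k2 \<in> S \<Longrightarrow> k1 \<noteq> k2 \<Longrightarrow> N (f k1 - f k2) \<le> B * norm (k1 - k2) powr \<alpha>"
proof -
  let ?S = "{(k1, k2). k1 \<in> S \<and> k2 \<in> S \<and> k1 \<noteq> k2}"
  let ?q = "\<lambda>(k1, k2). ennreal (N (f k1 - f k2) / norm (k1 - k2) powr \<alpha>)"
  have le: "(SUP k\<in>S. ennreal (N (f k))) \<le> ennreal B" "(SUP p\<in>?S. ?q p) \<le> ennreal B"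
    using order_trans[OF _ assms(1)[unfolded hoelder_norm_on_def]] by simp_all
  show "N (f k) \<le> B" if "k \<in> S"
    using SUP_upper[OF that, of "\<lambda>k. ennreal (N (f k))"] le(1) assms(2)
    by (metis ennreal_le_iff order_trans)
  assume k: "k1 \<in> S" "k2 \<in> S" "k1 \<noteq> k2"
  then have "?q (k1, k2) \<le> (SUP p\<in>?S. ?q p)" by (intro SUP_upper) auto
  from order_trans[OF this le(2)]
  have "ennreal (N (f k1 - f k2) / norm (k1 - k2) powr \<alpha>) \<le> ennreal B" by simp
  then have "N (f k1 - f k2) / norm (k1 - k2) powr \<alpha> \<le> B" using assms(2) by simp
  then show "N (f k1 - f k2) \<le> B * norm (k1 - k2) powr \<alpha>" using k(3) by (simp add: divide_le_eq)
qed

lemma hoelder_norm_on_leI: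
  assumes "\<And>k. k \<in> S \<Longrightarrow> N (f k) \<le> B"
    and "\<And>k1 k2. k1 \<in> S \<Longrightarrow> k2 \<in> S \<Longrightarrow> N (f k1 - f k2) \<le> B * norm (k1 - k2) powr \<alpha>" and "0 \<le> B"
  shows "hoelder_norm_on N \<alpha> S f \<le> ennreal (2 * B)"
proof -
  have "hoelder_norm_on N \<alpha> S f \<le> ennreal B + ennreal B"
    unfolding hoelder_norm_on_def
    by (intro add_mono SUP_least) (use assms in \<open>auto intro!: ennreal_leI simp: divide_le_eq\<close>)
  then show ?thesis using assms(3) by (simp add: ennreal_plus[symmetric] del: ennreal_plus)
qed

lemma hoelder_imp_continuous_on:
  fixes f :: "complex \<Rightarrow> complex^2^2"
  assumes "\<And>x y. x \<in> S \<Longrightarrow> y \<in> S \<Longrightarrow> x \<noteq> y \<Longrightarrow> norm (f y - f x) \<le> C * norm (y - x) powr \<alpha>" "0 < \<alpha>"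
  shows "continuous_on S f"
  unfolding continuous_on_def
proof
  fix x assume x: "x \<in> S"
  have "continuous_on UNIV (\<lambda>y. C * norm (y - x) powr \<alpha>)"
    using assms(2) by (intro continuous_on_mult continuous_on_const continuous_on_powr' continuous_on_norm continuous_on_diff continuous_on_id) auto
  then have "((\<lambda>y. C * norm (y - x) powr \<alpha>) \<longlongrightarrow> C * norm (x - x) powr \<alpha>) (at x within S)"
    by (metis UNIV_I continuous_on_def tendsto_within_subset subset_UNIV)
  then have lim: "((\<lambda>y. C * norm (y - x) powr \<alpha>) \<longlongrightarrow> 0) (at x within S)" by simp
  have "((\<lambda>y. f y - f x) \<longlongrightarrow> 0) (at x within S)"
    by (rule Lim_null_comparison[OF _ lim]) (use assms(1) x in \<open>auto simp: eventually_at_filter\<close>)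
  then show "(f \<longlongrightarrow> f x) (at x within S)" by (rule LIM_zero_cancel)
qed

text \<open>
  Continuity holds on the disc and, through \<open>z = 1/w\<close>, on the complement of the open disc. These closed
  sets cover the plane, so \<open>\<psi>\<close> is continuous everywhere, which is what makes the integrands measurable.
\<close>

lemma Calpha_norm_le_imp:
  assumes K: "K > 0" "\<And>A. norm A \<le> K * N A"
    and \<psi>: "Calpha_norm N \<alpha> \<psi> \<le> ennreal B" "0 \<le> B" and \<alpha>: "0 < \<alpha>"
  shows "continuous_on UNIV \<psi>" and "norm (\<psi> k) \<le> K * B"
proof -
  have h: "hoelder_norm_on N \<alpha> E1 \<psi> \<le> ennreal B" "hoelder_norm_on N \<alpha> (E1 - {0}) (\<lambda>k. \<psi> (inverse k)) \<le> ennreal B"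
    using order_trans[OF _ \<psi>(1)[unfolded Calpha_norm_def]] by simp_all
  have leK: "norm A \<le> K * t" if "N A \<le> t" for A t
    by (rule order_trans[OF K(2) mult_left_mono[OF that]]) (use K(1) in simp)
  note 1 = hoelder_norm_on_leD[OF h(1) \<psi>(2)] and 2 = hoelder_norm_on_leD[OF h(2) \<psi>(2)]
  have out: "inverse k \<in> E1 - {0}" if "k \<in> - ball 0 1" for k :: complex
    using that by (auto simp: E1_def norm_inverse inverse_le_1_iff)
  show "norm (\<psi> k) \<le> K * B"
  proof (cases "k \<in> E1")
    case False
    then have "inverse k \<in> E1 - {0}" by (intro out) (auto simp: E1_def)
    from 2(1)[OF this] show ?thesis by (intro leK) simp
  qed (auto intro: leK 1)
  have c1: "continuous_on E1 \<psi>"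
    by (rule hoelder_imp_continuous_on[of _ _ "K * B", OF _ \<alpha>]) (use 1(2) leK in \<open>auto simp: mult.assoc\<close>)
  have c2: "continuous_on (E1 - {0}) (\<lambda>k. \<psi> (inverse k))"
    by (rule hoelder_imp_continuous_on[of _ _ "K * B", OF _ \<alpha>]) (use 2(2) leK in \<open>auto simp: mult.assoc\<close>)
  have "continuous_on (- ball 0 1) (\<lambda>k. \<psi> (inverse (inverse k)))"
    by (rule continuous_on_compose2[OF c2]) (use out in \<open>auto intro!: continuous_intros\<close>)
  then have c3: "continuous_on (- ball 0 1) \<psi>" by simp
  have "continuous_on (E1 \<union> - ball 0 1) \<psi>"
    by (intro continuous_on_closed_Un c1 c3) (auto simp: E1_def closed_Compl)
  moreover have "E1 \<union> - ball 0 1 = UNIV" by (auto simp: E1_def)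
  ultimately show "continuous_on UNIV \<psi>" by simp
qed

lemma Calpha_norm_le:
  assumes K: "K > 0" "\<And>A. N A \<le> K * norm A" and f: "sphere_hoelder_bound \<alpha> D f" and D: "0 \<le> D"
  shows "Calpha_norm N \<alpha> f \<le> ennreal (4 * K * D)"
proof -
  have leK: "N A \<le> K * t" if "norm A \<le> t" for A t
    by (rule order_trans[OF K(2) mult_left_mono[OF that]]) (use K(1) in simp)
  have KD: "0 \<le> K * D" using K D by simp
  have "hoelder_norm_on N \<alpha> E1 f \<le> ennreal (2 * (K * D))"
    "hoelder_norm_on N \<alpha> (E1 - {0}) (\<lambda>k. f (inverse k)) \<le> ennreal (2 * (K * D))"
    using f unfolding sphere_hoelder_bound_def
    by (intro hoelder_norm_on_leI KD, auto intro: leK simp: mult.assoc)+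
  from add_mono[OF this] show ?thesis
    using KD unfolding Calpha_norm_def by (simp add: ennreal_plus[symmetric] mult_ac del: ennreal_plus)
qed

section \<open>Boundedness of the operator\<close>

definition E21 :: "complex^2^2" where "E21 = vector [vector [0, 0], vector [1, 0]]"
definition E12 :: "complex^2^2" where "E12 = vector [vector [0, 1], vector [0, 0]]"

lemma norm_vec2: "norm (v :: complex^2) = sqrt (norm (v$1)^2 + norm (v$2)^2)"
  by (simp add: norm_vec_def L2_set_def UNIV_2)

lemma norm_mult_E21: "norm (A ** E21) \<le> norm A"
  by (rule norm_le_componentwise_cart)
    (simp add: norm_vec2 E21_def matrix_matrix_mult_def UNIV_2)

lemma norm_mult_E12: "norm (A ** E12) \<le> norm A"
  by (rule norm_le_componentwise_cart)
    (simp add: norm_vec2 E12_def matrix_matrix_mult_def UNIV_2)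

lemma w_minus_eq: "w_minus r z x = cscale (r z * exp (2 * \<i> * z * of_real x)) E21"
  by (simp add: w_minus_def E21_def cscale_def vec_eq_iff forall_2)

lemma w_plus_eq: "w_plus r z x = cscale (r z * exp (- 2 * \<i> * z * of_real x)) E12"
  by (simp add: w_plus_def E12_def cscale_def vec_eq_iff forall_2)

lemma half_planes_borel: "upper_half_plane \<in> sets borel" "lower_half_plane \<in> sets borel"
  unfolding upper_half_plane_def lower_half_plane_def
  by (auto intro!: borel_open open_halfspace_Im_gt open_halfspace_Im_lt)

text \<open>
  The modulus of \<open>exp (\<plusminus> 2 i z x)\<close> is \<open>exp (\<mp> 2 x Im z)\<close>. For either sign of \<open>x\<close> the
  definition integrates \<open>w\<^sub>-\<close> over the half plane where \<open>x Im z > 0\<close> and \<open>w\<^sub>+\<close> over the one where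
  \<open>x Im z < 0\<close>, so the exponentials have modulus at most 1 and the bound is uniform in \<open>x\<close>. At \<open>x = 0\<close>
  the operator vanishes.
\<close>

lemma RT_hoelder:
  assumes q: "2 < q" and \<alpha>: "0 < \<alpha>" "\<alpha> < 1 - 2 / q"
  obtains M where "M > 0" and "\<And>rp rm \<psi> x B. rp \<in> Lpnu q 2 \<Longrightarrow> rm \<in> Lpnu q 2 \<Longrightarrow> B \<ge> 0 \<Longrightarrow>
    continuous_on UNIV \<psi> \<Longrightarrow> (\<And>z. norm (\<psi> z) \<le> B) \<Longrightarrow>
    sphere_hoelder_bound \<alpha> (M * B * (Lpnu_norm q 2 rp + Lpnu_norm q 2 rm)) (RT rp rm x \<psi>)"
proof -
  obtain M where M0: "M > 0" and M: "\<And>r G \<psi> e E B. r \<in> Lpnu q 2 \<Longrightarrow> G \<in> sets borel \<Longrightarrow> B \<ge> 0 \<Longrightarrow>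
    continuous_on UNIV \<psi> \<Longrightarrow> continuous_on UNIV e \<Longrightarrow> (\<And>A :: complex^2^2. norm (A ** E) \<le> norm A) \<Longrightarrow>
    (\<And>z. norm (\<psi> z) \<le> B) \<Longrightarrow> (\<And>z. z \<in> G \<Longrightarrow> norm (e z) \<le> 1) \<Longrightarrow>
    sphere_hoelder_bound \<alpha> (M * B * Lpnu_norm q 2 r) (cauchy_T G (\<lambda>z. \<psi> z ** cscale (r z * e z) E))"
    by (rule cauchy_T_hoelder[OF assms]) blast
  show thesis
  proof (rule that[OF M0])
    fix rp rm and \<psi> :: "complex \<Rightarrow> complex^2^2" and B x :: real
    assume r: "rp \<in> Lpnu q 2" "rm \<in> Lpnu q 2" and B: "0 \<le> B"
      and \<psi>: "continuous_on UNIV \<psi>" "\<And>z. norm (\<psi> z) \<le> B"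
    have minus: "sphere_hoelder_bound \<alpha> (M * B * Lpnu_norm q 2 rm) (cauchy_T G (\<lambda>z. \<psi> z ** w_minus rm z x))"
      if "G \<in> sets borel" "\<And>z. z \<in> G \<Longrightarrow> 0 \<le> Im z * x" for G
      unfolding w_minus_eq using that
      by (intro M r B \<psi>(1) norm_mult_E21 \<psi>(2) continuous_intros) (auto simp: mult.commute)
    have plus: "sphere_hoelder_bound \<alpha> (M * B * Lpnu_norm q 2 rp) (cauchy_T G (\<lambda>z. \<psi> z ** w_plus rp z x))"
      if "G \<in> sets borel" "\<And>z. z \<in> G \<Longrightarrow> Im z * x \<le> 0" for G
      unfolding w_plus_eq using that
      by (intro M r B \<psi>(1) norm_mult_E12 \<psi>(2) continuous_intros) (auto simp: mult.commute)
    have sum: "M * B * Lpnu_norm q 2 rm + M * B * Lpnu_norm q 2 rp = M * B * (Lpnu_norm q 2 rp + Lpnu_norm q 2 rm)"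
      by (simp add: algebra_simps)
    note add = sphere_hoelder_bound_add[of \<alpha> "M * B * Lpnu_norm q 2 rm" _ "M * B * Lpnu_norm q 2 rp", unfolded sum]
    consider "x > 0" | "x < 0" | "x = 0" by linarith
    then show "sphere_hoelder_bound \<alpha> (M * B * (Lpnu_norm q 2 rp + Lpnu_norm q 2 rm)) (RT rp rm x \<psi>)"
    proof cases
      case 1
      then have "RT rp rm x \<psi> = (\<lambda>k. cauchy_T upper_half_plane (\<lambda>z. \<psi> z ** w_minus rm z x) k +
          cauchy_T lower_half_plane (\<lambda>z. \<psi> z ** w_plus rp z x) k)"
        by (simp add: RT_def fun_eq_iff)
      then show ?thesis using 1
        by (simp only:) (intro add minus plus half_planes_borel;
          auto simp: upper_half_plane_def lower_half_plane_def mult_nonpos_nonneg)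
    next
      case 2
      then have "RT rp rm x \<psi> = (\<lambda>k. cauchy_T lower_half_plane (\<lambda>z. \<psi> z ** w_minus rm z x) k +
          cauchy_T upper_half_plane (\<lambda>z. \<psi> z ** w_plus rp z x) k)"
        by (simp add: RT_def fun_eq_iff)
      then show ?thesis using 2
        by (simp only:) (intro add minus plus half_planes_borel;
          auto simp: upper_half_plane_def lower_half_plane_def mult_nonneg_nonpos mult_nonpos_nonpos)
    next
      case 3
      then have "RT rp rm x \<psi> = (\<lambda>k. 0)" by (simp add: RT_def fun_eq_iff)
      moreover have "0 \<le> M * B * (Lpnu_norm q 2 rp + Lpnu_norm q 2 rm)"
        using M0 B Lpnu_norm_nonneg by (intro mult_nonneg_nonneg add_nonneg_nonneg) auto
      ultimately show ?thesis using sphere_hoelder_bound_mono[OF sphere_hoelder_bound_zero] by simp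
    qed
  qed
qed

theorem theorem5:
  fixes p q \<alpha> :: real and N :: "complex^2^2 \<Rightarrow> real"
  assumes "is_matrix_norm N"
    and "p > 0" and "q > 0" and "1 / p + 1 / q < 1 / 2"
    and "\<alpha> = 1 - 2 * (1 / p + 1 / q)"
  shows "\<exists>M>0. \<forall>rp\<in>Lpnu q 2. \<forall>rm\<in>Lpnu q 2.
           (\<forall>\<psi>\<in>Linf_Calpha N \<alpha>. \<forall>x. RT rp rm x (\<lambda>z. \<psi> z x) \<in> Calpha N \<alpha>) \<and>
           (\<forall>x. Calpha_opnorm N \<alpha> (RT rp rm x)
                  \<le> ennreal (M * (Lpnu_norm q 2 rp + Lpnu_norm q 2 rm)))"
proof -
  have p: "0 < 1 / p" using assms by simp
  then have "1 / q < 1 / 2" using assms(4) by linarith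
  then have q: "2 < q" using assms(3) by (simp add: field_simps)
  have \<alpha>: "0 < \<alpha>" "\<alpha> < 1 - 2 / q" using assms(4,5) p by (simp_all add: distrib_left)
  obtain K where K: "K > 0" "\<And>A. N A \<le> K * norm A" "\<And>A. norm A \<le> K * N A"
    using matrix_norm_equivalent[OF assms(1)] by blast
  obtain M where M: "M > 0" "\<And>rp rm \<psi> x B. rp \<in> Lpnu q 2 \<Longrightarrow> rm \<in> Lpnu q 2 \<Longrightarrow> B \<ge> 0 \<Longrightarrow>
      continuous_on UNIV \<psi> \<Longrightarrow> (\<And>z. norm (\<psi> z) \<le> B) \<Longrightarrow>
      sphere_hoelder_bound \<alpha> (M * B * (Lpnu_norm q 2 rp + Lpnu_norm q 2 rm)) (RT rp rm x \<psi>)"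
    by (rule RT_hoelder[OF q \<alpha>]) blast
  define M' where "M' = 4 * K * M * K"
  have bound: "Calpha_norm N \<alpha> (RT rp rm x \<psi>) \<le> ennreal (M' * B * (Lpnu_norm q 2 rp + Lpnu_norm q 2 rm))"
    if r: "rp \<in> Lpnu q 2" "rm \<in> Lpnu q 2" and \<psi>: "Calpha_norm N \<alpha> \<psi> \<le> ennreal B" "0 \<le> B" for rp rm x \<psi> B
  proof -
    note c = Calpha_norm_le_imp[where N = N, OF K(1,3) \<psi> \<alpha>(1)]
    have "Calpha_norm N \<alpha> (RT rp rm x \<psi>) \<le> ennreal (4 * K * (M * (K * B) * (Lpnu_norm q 2 rp + Lpnu_norm q 2 rm)))"
      by (rule Calpha_norm_le[OF K(1,2) M(2)[OF r _ c]])
        (use K M \<psi> in \<open>auto intro!: mult_nonneg_nonneg add_nonneg_nonneg Lpnu_norm_nonneg\<close>)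
    then show ?thesis by (simp add: M'_def mult_ac)
  qed
  show ?thesis
  proof (intro exI[of _ M'] conjI ballI allI)
    show "0 < M'" using K M by (simp add: M'_def)
  next
    fix rp rm \<psi> x assume r: "rp \<in> Lpnu q 2" "rm \<in> Lpnu q 2" and \<psi>: "\<psi> \<in> Linf_Calpha N \<alpha>"
    have "Calpha_norm N \<alpha> (\<lambda>k. \<psi> k x) \<le> (SUP x. Calpha_norm N \<alpha> (\<lambda>k. \<psi> k x))"
      by (rule SUP_upper) simp
    also have "\<dots> < \<infinity>" using \<psi> by (simp add: Linf_Calpha_def)
    finally obtain B where "Calpha_norm N \<alpha> (\<lambda>k. \<psi> k x) = ennreal B" "0 \<le> B"
      by (cases "Calpha_norm N \<alpha> (\<lambda>k. \<psi> k x)") auto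
    then show "RT rp rm x (\<lambda>z. \<psi> z x) \<in> Calpha N \<alpha>"
      using bound[OF r, of "\<lambda>k. \<psi> k x" B x] by (auto simp: Calpha_def intro: order_le_less_trans)
  next
    fix rp rm x assume r: "rp \<in> Lpnu q 2" "rm \<in> Lpnu q 2"
    show "Calpha_opnorm N \<alpha> (RT rp rm x) \<le> ennreal (M' * (Lpnu_norm q 2 rp + Lpnu_norm q 2 rm))"
      unfolding Calpha_opnorm_def
      by (rule SUP_least) (use bound[OF r, of _ 1 x] in auto)
  qed
qed

end
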